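(* For every $n\ge 0$, the geometric realization of the $n$-fold simplicial set $\mathfrak{B}^n\mathbb{F}_1\langle 1\rangle$ is homeomorphic to the sphere $S^n=D^n/\partial D^n$.
   Context: $\mathrm{Fin}_\ast$ is the category of the finite pointed sets $\langle n\rangle=\{\ast,1,\dots,n\}$ (basepoint $\ast$) and pointed maps; the smash product is regarded as a functor $\wedge\colon\mathrm{Fin}_\ast\times\mathrm{Fin}_\ast\to\mathrm{Fin}_\ast$, $\langle a\rangle\wedge\langle b\rangle=\langle ab\rangle$ (using, e.g., the lexicographic ordering of pairs). $\mathrm{Mod}_{\mathbb{F}_1}$ is the category of pointed functors $\mathrm{Fin}_\ast\to\mathrm{Set}_\ast$, i.e. those sending $\langle 0\rangle$ to a one-point set, and $\mathbb{F}_1\in\mathrm{Mod}_{\mathbb{F}_1}$ is the inclusion $\mathrm{Fin}_\ast\hookrightarrow\mathrm{Set}_\ast$. For a category $\mathcal{C}$, $s^n\mathcal{C}$ denotes the category of functors $(\Delta^{\mathrm{op}})^n\to\mathcal{C}$; for $\mathcal C=\mathrm{Set}$ these are $n$-fold simplicial sets, and multidegree $[k_1,\dots,k_n]$ means the object $([k_1],\dots,[k_n])$. An object of $s^n\mathrm{Mod}_{\mathbb{F}_1}$ is regarded equivalently as a functor $(\Delta^{\mathrm{op}})^n\times\mathrm{Fin}_\ast\to\mathrm{Set}_\ast$ or as a functor $\mathrm{Fin}_\ast\to s^n\mathrm{Set}_\ast$. Let $\mathtt{s}\colon\Delta^{\mathrm{op}}\to\mathrm{Fin}_\ast$ be the pointed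 simplicial finite set $\Delta^1/\partial\Delta^1$, so $\mathtt{s}[n]=\langle n\rangle$. The delooping functor $\mathfrak{B}\colon s^n\mathrm{Mod}_{\mathbb{F}_1}\to s^{n+1}\mathrm{Mod}_{\mathbb{F}_1}$ is pullback along $\Delta^{\mathrm{op}}\times\mathrm{Fin}_\ast\xrightarrow{\mathtt{s}\times\mathrm{id}}\mathrm{Fin}_\ast\times\mathrm{Fin}_\ast\xrightarrow{\wedge}\mathrm{Fin}_\ast$ in the $\mathrm{Fin}_\ast$ variable, i.e. $(\mathfrak{B}X)([k_1,\dots,k_{n+1}],\langle m\rangle)=X([k_1,\dots,k_n],\langle k_{n+1}\rangle\wedge\langle m\rangle)$, and $\mathfrak{B}^n$ is its $n$-fold iterate (with $\mathfrak{B}^0=\mathrm{id}$). Thus $\mathfrak{B}^n\mathbb{F}_1\langle 1\rangle\in s^n\mathrm{Set}_\ast$. The geometric realization of an $n$-fold simplicial set $X$ is the coend of $X_{k_1,\dots,k_n}\times|\Delta^{k_1}|\times\cdots\times|\Delta^{k_n}|$ over $\Delta^n$. A quotient by the empty subspace means adjoining a disjoint basepoint (so $D^0/\partial D^0=S^0$). *)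

theory Defs
  imports "HOL-Homology.Simplices"
begin

section \<open>The categories \<open>\<Delta>\<close> and \<open>Fin\<^sub>*\<close>\<close>

text \<open>
  Both categories have the natural numbers as objects: \<open>n\<close> stands for \<open>[n] = {0 < \<dots> < n}\<close> in
  \<open>\<Delta>\<close>, and for \<open>\<langle>n\<rangle> = {*, 1, \<dots>, n}\<close> with the basepoint \<open>*\<close> encoded as \<open>0\<close> in \<open>Fin\<^sub>*\<close>. The
  underlying set is \<open>{..n}\<close> in both cases. The underlying functions of arrows are extensional, so
  that equality of arrows is equality of functions on the source.
\<close>

record arr =
  src :: nat
  tgt :: nat
  app :: "nat \<Rightarrow> nat"

definition id_arr :: "nat \<Rightarrow> arr" where
  "id_arr n = \<lparr>src = n, tgt = n, app = (\<lambda>i\<in>{..n}. i)\<rparr>"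

definition comp_arr :: "arr \<Rightarrow> arr \<Rightarrow> arr" where
  "comp_arr g f = \<lparr>src = src f, tgt = tgt g, app = compose {..src f} (app g) (app f)\<rparr>"

definition Delta_arr :: "arr set" where
  "Delta_arr = {\<alpha>. app \<alpha> \<in> {..src \<alpha>} \<rightarrow>\<^sub>E {..tgt \<alpha>} \<and> mono_on {..src \<alpha>} (app \<alpha>)}"

definition Fin_arr :: "arr set" where
  "Fin_arr = {f. app f \<in> {..src f} \<rightarrow>\<^sub>E {..tgt f} \<and> app f 0 = 0}"

text \<open>The arrows of \<open>\<Delta>\<^sup>n\<close>, from \<open>map src \<alpha>s\<close> to \<open>map tgt \<alpha>s\<close>.\<close>

definition Delta_arrs :: "nat \<Rightarrow> arr list set" where
  "Delta_arrs n = {\<alpha>s. length \<alpha>s = n \<and> set \<alpha>s \<subseteq> Delta_arr}"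

section \<open>The smash product and the simplicial circle\<close>

text \<open>
  \<open>lex_pair b i j\<close> is the element \<open>i \<and> j\<close> of \<open>\<langle>a\<rangle> \<and> \<langle>b\<rangle> = \<langle>a * b\<rangle>\<close>: the pairs of non-basepoints
  \<open>(i, j) \<in> {1..a} \<times> {1..b}\<close> are numbered lexicographically.
\<close>

definition lex_pair :: "nat \<Rightarrow> nat \<Rightarrow> nat \<Rightarrow> nat" where
  "lex_pair b i j = (if i = 0 \<or> j = 0 then 0 else (i - 1) * b + j)"

text \<open>The arrow \<open>f \<and> g\<close>, which sends \<open>i \<and> j\<close> to \<open>f i \<and> g j\<close>; see \<open>smash_lex_pair\<close> below.\<close>

definition smash :: "arr \<Rightarrow> arr \<Rightarrow> arr" where
  "smash f g = \<lparr>src = src f * src g, tgt = tgt f * tgt g,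
     app = (\<lambda>x\<in>{..src f * src g}. if x = 0 then 0 else
       lex_pair (tgt g) (app f ((x - 1) div src g + 1)) (app g ((x - 1) mod src g + 1)))\<rparr>"

text \<open>
  A \<open>k\<close>-simplex of \<open>\<Delta>\<^sup>1\<close> is a monotone map \<open>\<sigma> : [k] \<rightarrow> [1]\<close>; it lies in \<open>\<partial>\<Delta>\<^sup>1\<close> iff it is not
  surjective. The \<open>k\<close>-simplices outside \<open>\<partial>\<Delta>\<^sup>1\<close> are the maps \<open>interval_simplex i\<close> with \<open>1 \<le> i \<le> k\<close>,
  and \<open>i = 0\<close> gives a simplex of \<open>\<partial>\<Delta>\<^sup>1\<close>. This identifies the \<open>k\<close>-simplices of \<open>\<Delta>\<^sup>1/\<partial>\<Delta>\<^sup>1\<close> with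
  \<open>\<langle>k\<rangle>\<close>; \<open>circle_class k\<close> is the resulting quotient map \<open>\<Delta>\<^sup>1\<^sub>k \<rightarrow> \<langle>k\<rangle>\<close>.
\<close>

definition interval_simplex :: "nat \<Rightarrow> nat \<Rightarrow> nat" where
  "interval_simplex i = (\<lambda>j. if i \<le> j then 1 else 0)"

definition circle_class :: "nat \<Rightarrow> (nat \<Rightarrow> nat) \<Rightarrow> nat" where
  "circle_class k \<sigma> = (if \<sigma> ` {..k} = {0, 1} then LEAST j. \<sigma> j = 1 else 0)"

text \<open>
  The functor \<open>s = \<Delta>\<^sup>1/\<partial>\<Delta>\<^sup>1 : \<Delta>\<^sup>o\<^sup>p \<rightarrow> Fin\<^sub>*\<close> on an arrow \<open>\<alpha> : [k] \<rightarrow> [l]\<close>: the pointed map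
  \<open>\<langle>l\<rangle> \<rightarrow> \<langle>k\<rangle>\<close> induced by precomposition with \<open>\<alpha>\<close>.
\<close>

definition circle :: "arr \<Rightarrow> arr" where
  "circle \<alpha> = \<lparr>src = tgt \<alpha>, tgt = src \<alpha>,
     app = (\<lambda>i\<in>{..tgt \<alpha>}. circle_class (src \<alpha>) (interval_simplex i \<circ> app \<alpha>))\<rparr>"

section \<open>Multisimplicial \<open>\<bbbF>\<^sub>1\<close>-modules and delooping\<close>

text \<open>
  A functor \<open>(\<Delta>\<^sup>o\<^sup>p)\<^sup>n \<times> Fin\<^sub>* \<rightarrow> Set\<^sub>*\<close>. Multidegrees and arrows of \<open>\<Delta>\<^sup>n\<close> are lists of length \<open>n\<close>.
  For \<open>\<alpha>s : ks \<rightarrow> ls\<close> in \<open>\<Delta>\<^sup>n\<close> and \<open>f : \<langle>a\<rangle> \<rightarrow> \<langle>b\<rangle>\<close>, the function \<open>mact X \<alpha>s f\<close> maps \<open>mobj X ls a\<close>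
  to \<open>mobj X ks b\<close>. The number \<open>n\<close> is not part of the data; values at lists of a length other
  than \<open>n\<close> are irrelevant.
\<close>

record 'a multi_module =
  mobj :: "nat list \<Rightarrow> nat \<Rightarrow> 'a set"
  mbase :: "nat list \<Rightarrow> nat \<Rightarrow> 'a"
  mact :: "arr list \<Rightarrow> arr \<Rightarrow> 'a \<Rightarrow> 'a"

text \<open>The objects of \<open>s\<^sup>n Mod\<close>; the last conjunct says that the functor is pointed.\<close>

definition multi_module :: "nat \<Rightarrow> 'a multi_module \<Rightarrow> bool" where
  "multi_module n X \<longleftrightarrow>
     (\<forall>ks m. length ks = n \<longrightarrow> mbase X ks m \<in> mobj X ks m) \<and>
     (\<forall>\<alpha>s\<in>Delta_arrs n. \<forall>f\<in>Fin_arr.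
        mact X \<alpha>s f \<in> mobj X (map tgt \<alpha>s) (src f) \<rightarrow> mobj X (map src \<alpha>s) (tgt f) \<and>
        mact X \<alpha>s f (mbase X (map tgt \<alpha>s) (src f)) = mbase X (map src \<alpha>s) (tgt f)) \<and>
     (\<forall>ks m. length ks = n \<longrightarrow> (\<forall>x\<in>mobj X ks m. mact X (map id_arr ks) (id_arr m) x = x)) \<and>
     (\<forall>\<alpha>s\<in>Delta_arrs n. \<forall>\<beta>s\<in>Delta_arrs n. \<forall>f\<in>Fin_arr. \<forall>g\<in>Fin_arr.
        map tgt \<alpha>s = map src \<beta>s \<longrightarrow> tgt f = src g \<longrightarrow>
        (\<forall>x\<in>mobj X (map tgt \<beta>s) (src f).
           mact X (map2 comp_arr \<beta>s \<alpha>s) (comp_arr g f) x = mact X \<alpha>s g (mact X \<beta>s f x))) \<and>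
     (\<forall>ks. length ks = n \<longrightarrow> mobj X ks 0 = {mbase X ks 0})"

definition F1 :: "nat multi_module" where
  "F1 = \<lparr>mobj = (\<lambda>ks m. {..m}), mbase = (\<lambda>ks m. 0), mact = (\<lambda>\<alpha>s f. app f)\<rparr>"

definition deloop :: "'a multi_module \<Rightarrow> 'a multi_module" where
  "deloop X = \<lparr>mobj = (\<lambda>ks m. mobj X (butlast ks) (last ks * m)),
     mbase = (\<lambda>ks m. mbase X (butlast ks) (last ks * m)),
     mact = (\<lambda>\<alpha>s f. mact X (butlast \<alpha>s) (smash (circle (last \<alpha>s)) f))\<rparr>"

section \<open>Multisimplicial sets and geometric realization\<close>

record 'a multi_sset =
  cells :: "nat list \<Rightarrow> 'a set"
  base :: "nat list \<Rightarrow> 'a"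
  act :: "arr list \<Rightarrow> 'a \<Rightarrow> 'a"

text \<open>The objects of \<open>s\<^sup>n Set\<^sub>*\<close>.\<close>

definition multi_sset :: "nat \<Rightarrow> 'a multi_sset \<Rightarrow> bool" where
  "multi_sset n X \<longleftrightarrow>
     (\<forall>ks. length ks = n \<longrightarrow> base X ks \<in> cells X ks) \<and>
     (\<forall>\<alpha>s\<in>Delta_arrs n. act X \<alpha>s \<in> cells X (map tgt \<alpha>s) \<rightarrow> cells X (map src \<alpha>s) \<and>
        act X \<alpha>s (base X (map tgt \<alpha>s)) = base X (map src \<alpha>s)) \<and>
     (\<forall>ks. length ks = n \<longrightarrow> (\<forall>x\<in>cells X ks. act X (map id_arr ks) x = x)) \<and>
     (\<forall>\<alpha>s\<in>Delta_arrs n. \<forall>\<beta>s\<in>Delta_arrs n. map tgt \<alpha>s = map src \<beta>s \<longrightarrow>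
        (\<forall>x\<in>cells X (map tgt \<beta>s). act X (map2 comp_arr \<beta>s \<alpha>s) x = act X \<alpha>s (act X \<beta>s x)))"

definition eval_at :: "'a multi_module \<Rightarrow> nat \<Rightarrow> 'a multi_sset" where
  "eval_at X m = \<lparr>cells = (\<lambda>ks. mobj X ks m), base = (\<lambda>ks. mbase X ks m),
     act = (\<lambda>\<alpha>s. mact X \<alpha>s (id_arr m))\<rparr>"

text \<open>The final topology on the set \<open>Y\<close> with respect to a function \<open>q : T \<rightarrow> Y\<close>.\<close>

definition final_topology :: "'b set \<Rightarrow> 'a topology \<Rightarrow> ('a \<Rightarrow> 'b) \<Rightarrow> 'b topology" where
  "final_topology Y T q = topology (\<lambda>U. U \<subseteq> Y \<and> openin T {x \<in> topspace T. q x \<in> U})"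

definition simplex_map :: "arr \<Rightarrow> (nat \<Rightarrow> real) \<Rightarrow> (nat \<Rightarrow> real)" where
  "simplex_map \<alpha> t = (\<lambda>j. \<Sum>i | i \<le> src \<alpha> \<and> app \<alpha> i = j. t i)"

definition simplex_product :: "nat list \<Rightarrow> (nat \<Rightarrow> nat \<Rightarrow> real) topology" where
  "simplex_product ks = product_topology
     (\<lambda>i. subtopology (powertop_real UNIV) (standard_simplex (ks ! i))) {..<length ks}"

definition realization_sum ::
    "nat \<Rightarrow> 'a multi_sset \<Rightarrow> (nat list \<times> 'a \<times> (nat \<Rightarrow> nat \<Rightarrow> real)) topology" where
  "realization_sum n X = sum_topology
     (\<lambda>ks. prod_topology (discrete_topology (cells X ks)) (simplex_product ks)) {ks. length ks = n}"

text \<open>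
  The coend is the coequalizer of the two maps
  \<open>\<Squnion>\<^bsub>\<alpha> : ks \<rightarrow> ls\<^esub> X\<^sub>l\<^sub>s \<times> |\<Delta>\<^sup>k\<^sup>s| \<rightarrow> \<Squnion>\<^bsub>ks\<^esub> X\<^sub>k\<^sub>s \<times> |\<Delta>\<^sup>k\<^sup>s|\<close> sending \<open>(\<alpha>, x, t)\<close> to
  \<open>(\<alpha>\<^sup>* x, t)\<close> and \<open>(x, \<alpha>\<^sub>* t)\<close>, that is, the quotient by the equivalence relation generated by
  these identifications.
\<close>

definition coend_glue ::
    "nat \<Rightarrow> 'a multi_sset \<Rightarrow> (nat list \<times> 'a \<times> (nat \<Rightarrow> nat \<Rightarrow> real)) rel" where
  "coend_glue n X =
     {((map src \<alpha>s, act X \<alpha>s x, t), (map tgt \<alpha>s, x, \<lambda>i\<in>{..<n}. simplex_map (\<alpha>s ! i) (t i)))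
      |\<alpha>s x t. \<alpha>s \<in> Delta_arrs n \<and> x \<in> cells X (map tgt \<alpha>s) \<and>
        t \<in> topspace (simplex_product (map src \<alpha>s))}"

definition coend_equiv ::
    "nat \<Rightarrow> 'a multi_sset \<Rightarrow> (nat list \<times> 'a \<times> (nat \<Rightarrow> nat \<Rightarrow> real)) rel" where
  "coend_equiv n X = (coend_glue n X \<union> (coend_glue n X)\<inverse>)\<^sup>*"

definition geometric_realization ::
    "nat \<Rightarrow> 'a multi_sset \<Rightarrow> (nat list \<times> 'a \<times> (nat \<Rightarrow> nat \<Rightarrow> real)) set topology" where
  "geometric_realization n X =
     final_topology (topspace (realization_sum n X) // coend_equiv n X)
       (realization_sum n X) (\<lambda>p. coend_equiv n X `` {p})"

section \<open>The sphere as a quotient of the disc\<close>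

definition disc :: "nat \<Rightarrow> (nat \<Rightarrow> real) topology" where
  "disc n = subtopology (Euclidean_space n) {x. (\<Sum>i<n. (x i)\<^sup>2) \<le> 1}"

definition disc_boundary :: "nat \<Rightarrow> (nat \<Rightarrow> real) set" where
  "disc_boundary n = {x \<in> topspace (disc n). (\<Sum>i<n. (x i)\<^sup>2) = 1}"

text \<open>
  The quotient \<open>T/A\<close>, with \<open>None\<close> the point to which \<open>A\<close> is collapsed. This point is present
  also if \<open>A = {}\<close>, and is then isolated.
\<close>

definition collapse :: "'a topology \<Rightarrow> 'a set \<Rightarrow> 'a option topology" where
  "collapse T A = final_topology (insert None (Some ` (topspace T - A))) T
     (\<lambda>x. if x \<in> A then None else Some x)"

section \<open>Well-definedness\<close>

lemma openin_final_topology: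
  "openin (final_topology Y T q) U \<longleftrightarrow> U \<subseteq> Y \<and> openin T {x \<in> topspace T. q x \<in> U}"
proof -
  have "istopology (\<lambda>U. U \<subseteq> Y \<and> openin T {x \<in> topspace T. q x \<in> U})"
    unfolding istopology_def
  proof (intro conjI allI impI; (elim conjE)?)
    fix S S' assume "openin T {x \<in> topspace T. q x \<in> S}" "openin T {x \<in> topspace T. q x \<in> S'}"
    then have "openin T ({x \<in> topspace T. q x \<in> S} \<inter> {x \<in> topspace T. q x \<in> S'})" by blast
    then show "openin T {x \<in> topspace T. q x \<in> S \<inter> S'}" by (rule back_subst) auto
  next
    fix \<K> assume *: "\<forall>K\<in>\<K>. K \<subseteq> Y \<and> openin T {x \<in> topspace T. q x \<in> K}"
    then have "openin T (\<Union>K\<in>\<K>. {x \<in> topspace T. q x \<in> K})" by blast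
    then show "openin T {x \<in> topspace T. q x \<in> \<Union> \<K>}" by (rule back_subst) auto
  qed auto
  then show ?thesis by (simp add: final_topology_def topology_inverse')
qed

lemma topspace_final_topology:
  assumes "\<And>x. x \<in> topspace T \<Longrightarrow> q x \<in> Y"
  shows "topspace (final_topology Y T q) = Y"
proof
  show "topspace (final_topology Y T q) \<subseteq> Y"
    by (metis openin_final_topology openin_topspace)
  have "{x \<in> topspace T. q x \<in> Y} = topspace T" using assms by auto
  then have "openin (final_topology Y T q) Y" by (simp add: openin_final_topology)
  then show "Y \<subseteq> topspace (final_topology Y T q)" by (rule openin_subset)
qed

lemma lex_pair_le:
  assumes "i \<le> a" "j \<le> b"
  shows "lex_pair b i j \<le> a * b"
proof (cases "i = 0 \<or> j = 0")
  case False
  then have "(i - 1) * b + j \<le> (i - 1) * b + b" using assms by simp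
  also have "\<dots> = i * b" using False by (cases i) auto
  also have "\<dots> \<le> a * b" using assms by simp
  finally show ?thesis using False by (simp add: lex_pair_def)
qed (auto simp: lex_pair_def)

lemma lex_pair_cases:
  assumes "x \<le> a * b" "x \<noteq> 0"
  obtains i j where "1 \<le> i" "i \<le> a" "1 \<le> j" "j \<le> b" "x = lex_pair b i j"
proof
  have b: "b > 0" using assms by (cases b) auto
  show "1 \<le> (x - 1) div b + 1" "1 \<le> (x - 1) mod b + 1" by auto
  have "x - 1 < a * b" using assms by linarith
  then show "(x - 1) div b + 1 \<le> a"
    by (simp add: Suc_leI less_mult_imp_div_less)
  show "(x - 1) mod b + 1 \<le> b" using b by (simp add: Suc_leI)
  show "x = lex_pair b ((x - 1) div b + 1) ((x - 1) mod b + 1)"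
    using assms by (simp add: lex_pair_def)
qed

lemma smash_lex_pair:
  assumes "f \<in> Fin_arr" "g \<in> Fin_arr" "i \<le> src f" "j \<le> src g"
  shows "app (smash f g) (lex_pair (src g) i j) = lex_pair (tgt g) (app f i) (app g j)"
proof (cases "i = 0 \<or> j = 0")
  case True
  then show ?thesis using assms by (auto simp: smash_def lex_pair_def Fin_arr_def)
next
  case False
  define b where "b = src g"
  obtain i' j' where ij: "i = Suc i'" "j = Suc j'" using False by (metis not0_implies_Suc)
  have j': "j' < b" using assms ij b_def by auto
  have x: "lex_pair b i j = Suc (i' * b + j')" using ij by (simp add: lex_pair_def)
  have "lex_pair b i j \<le> src f * b" using lex_pair_le assms b_def by blast
  moreover have "(i' * b + j') div b = i'" "(i' * b + j') mod b = j'" using j' by auto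
  ultimately show ?thesis unfolding smash_def b_def[symmetric] by (simp add: x[unfolded ij] ij)
qed

lemma app_Fin_arr: "f \<in> Fin_arr \<Longrightarrow> i \<le> src f \<Longrightarrow> app f i \<le> tgt f"
  by (auto simp: Fin_arr_def PiE_iff)

lemma smash_Fin_arr:
  assumes "f \<in> Fin_arr" "g \<in> Fin_arr"
  shows "smash f g \<in> Fin_arr"
proof -
  have "app (smash f g) x \<le> tgt f * tgt g" if x: "x \<le> src f * src g" for x
  proof (cases "x = 0")
    case False
    from lex_pair_cases[OF x False] obtain i j
      where "i \<le> src f" "j \<le> src g" "x = lex_pair (src g) i j" by metis
    then show ?thesis using assms by (simp add: smash_lex_pair lex_pair_le app_Fin_arr)
  qed (simp add: smash_def)
  then show ?thesis by (auto simp: Fin_arr_def smash_def)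
qed

lemma comp_Fin_arr:
  assumes "f \<in> Fin_arr" "g \<in> Fin_arr" "tgt f = src g"
  shows "comp_arr g f \<in> Fin_arr"
  using assms by (auto simp: Fin_arr_def comp_arr_def compose_def PiE_iff Pi_iff)

lemma id_Fin_arr: "id_arr n \<in> Fin_arr"
  by (auto simp: Fin_arr_def id_arr_def)

lemma app_ext:
  assumes "app f \<in> extensional {..src f}" "app g \<in> extensional {..src g}"
    "src f = src g" "tgt f = tgt g" "\<And>x. x \<le> src f \<Longrightarrow> app f x = app g x"
  shows "f = (g :: arr)"
proof -
  have "app f = app g" by (rule extensionalityI[of _ "{..src f}"]) (use assms in auto)
  then show ?thesis using assms by (cases f; cases g) auto
qed

lemma smash_id: "smash (id_arr a) (id_arr b) = id_arr (a * b)"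
proof (rule app_ext)
  fix x assume "x \<le> src (smash (id_arr a) (id_arr b))"
  then have x: "x \<le> a * b" by (simp add: smash_def id_arr_def)
  show "app (smash (id_arr a) (id_arr b)) x = app (id_arr (a * b)) x"
  proof (cases "x = 0")
    case False
    from lex_pair_cases[OF x False] obtain i j
      where "i \<le> a" "j \<le> b" "x = lex_pair b i j" by metis
    then show ?thesis
      using smash_lex_pair[OF id_Fin_arr id_Fin_arr, of i a j b] x by (simp add: id_arr_def)
  qed (simp add: smash_def id_arr_def)
qed (auto simp: smash_def id_arr_def)

lemma smash_comp:
  assumes "f \<in> Fin_arr" "f' \<in> Fin_arr" "tgt f = src f'"
    "g \<in> Fin_arr" "g' \<in> Fin_arr" "tgt g = src g'"
  shows "smash (comp_arr f' f) (comp_arr g' g) = comp_arr (smash f' g') (smash f g)"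
proof (rule app_ext)
  fix x assume "x \<le> src (smash (comp_arr f' f) (comp_arr g' g))"
  then have x: "x \<le> src f * src g" by (simp add: smash_def comp_arr_def)
  show "app (smash (comp_arr f' f) (comp_arr g' g)) x
      = app (comp_arr (smash f' g') (smash f g)) x"
  proof (cases "x = 0")
    case False
    from lex_pair_cases[OF x False] obtain i j
      where ij: "i \<le> src f" "j \<le> src g" "x = lex_pair (src g) i j" by metis
    have fi: "app f i \<le> src f'" "app g j \<le> src g'" using assms ij app_Fin_arr by metis+
    have "app (smash (comp_arr f' f) (comp_arr g' g)) x
        = lex_pair (tgt g') (app f' (app f i)) (app g' (app g j))"
      using smash_lex_pair[OF comp_Fin_arr[OF assms(1-3)] comp_Fin_arr[OF assms(4-6)], of i j] ij
      by (simp add: comp_arr_def compose_def)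
    also have "\<dots> = app (smash f' g') (app (smash f g) x)"
      using smash_lex_pair[OF assms(2,5) fi] smash_lex_pair[OF assms(1,4) ij(1,2)] assms ij by simp
    also have "\<dots> = app (comp_arr (smash f' g') (smash f g)) x"
      using x by (simp add: comp_arr_def compose_def) (simp add: smash_def)
    finally show ?thesis .
  qed (use assms in \<open>simp add: smash_def comp_arr_def compose_def\<close>)
qed (auto simp: smash_def comp_arr_def compose_def)

lemma circle_class_interval_simplex:
  assumes "i \<le> k"
  shows "circle_class k (interval_simplex i) = i"
proof (cases "i = 0")
  case False
  then have "interval_simplex i ` {..k} = {0, 1}"
    using assms by (auto simp: interval_simplex_def image_iff intro: bexI[of _ 0] bexI[of _ k])
  moreover have "(LEAST j. interval_simplex i j = 1) = i"
    by (rule Least_equality) (auto simp: interval_simplex_def split: if_splits)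
  ultimately show ?thesis by (simp add: circle_class_def)
qed (auto simp: circle_class_def interval_simplex_def)

lemma interval_simplex_circle_class:
  assumes "mono_on {..k} \<sigma>" "\<sigma> ` {..k} = {0, 1}" "j \<le> k"
  shows "interval_simplex (circle_class k \<sigma>) j = \<sigma> j"
proof -
  have "(1::nat) \<in> \<sigma> ` {..k}" using assms by auto
  then obtain j0 where j0: "j0 \<le> k" "\<sigma> j0 = 1" by auto
  define m where "m = (LEAST j. \<sigma> j = 1)"
  have m: "\<sigma> m = 1" "m \<le> k"
    unfolding m_def using j0 by (auto intro: LeastI Least_le order_trans)
  have "\<sigma> j \<in> {0, 1}" using assms by auto
  moreover have "\<sigma> j \<ge> 1" if "m \<le> j"
    using mono_onD[OF assms(1), of m j] that m assms(3) by auto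
  moreover have "\<sigma> j \<noteq> 1" if "j < m" using that not_less_Least unfolding m_def by blast
  moreover have "circle_class k \<sigma> = m" using assms(2) by (simp add: circle_class_def m_def)
  ultimately show ?thesis by (cases "m \<le> j") (auto simp: interval_simplex_def)
qed

lemma circle_class_le: "circle_class k \<sigma> \<le> k"
proof (cases "\<sigma> ` {..k} = {0, 1}")
  case True
  then have "(1::nat) \<in> \<sigma> ` {..k}" by auto
  then obtain j0 where "j0 \<le> k" "\<sigma> j0 = 1" by auto
  then show ?thesis using True by (auto simp: circle_class_def intro: Least_le order_trans)
qed (simp add: circle_class_def)

lemma circle_Fin_arr: "circle \<alpha> \<in> Fin_arr"
proof -
  have "(interval_simplex 0 \<circ> h) ` {..k} \<noteq> {0, 1}" for h k
    by (auto simp: interval_simplex_def)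
  then show ?thesis
    by (auto simp: circle_def Fin_arr_def circle_class_le circle_class_def[of _ "interval_simplex 0 \<circ> _"])
qed

lemma circle_class_cong:
  assumes "\<And>j. j \<le> k \<Longrightarrow> \<sigma> j = \<tau> j"
  shows "circle_class k \<sigma> = circle_class k \<tau>"
proof -
  have im: "\<sigma> ` {..k} = \<tau> ` {..k}" by (rule image_cong) (use assms in auto)
  show ?thesis
  proof (cases "\<sigma> ` {..k} = {0, 1}")
    case True
    then have "(1::nat) \<in> \<sigma> ` {..k}" by blast
    then obtain j0 where j0: "j0 \<le> k" "\<sigma> j0 = 1" by (metis atMost_iff imageE)
    define m where "m = (LEAST j. \<sigma> j = 1)"
    have m: "\<sigma> m = 1" unfolding m_def using j0(2) by (rule LeastI)
    have m_le: "m \<le> j" if "\<sigma> j = 1" for j unfolding m_def using that by (rule Least_le)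
    have mk: "m \<le> k" using m_le[OF j0(2)] j0(1) by (rule order_trans)
    have "(LEAST j. \<tau> j = 1) = m"
    proof (rule Least_equality)
      show "\<tau> m = 1" using assms[OF mk] m by metis
      show "m \<le> j" if "\<tau> j = 1" for j
        using that assms[of j] m_le[of j] mk by (metis linorder_linear order_trans)
    qed
    then show ?thesis using True im by (metis circle_class_def m_def)
  next
    case False
    then show ?thesis using im by (simp only: circle_class_def) simp
  qed
qed

text \<open>The class of \<open>\<sigma> \<circ> \<alpha>\<close> depends only on the class of \<open>\<sigma>\<close>, and is its image under \<open>circle \<alpha>\<close>.\<close>

lemma circle_circle_class:
  assumes "\<alpha> \<in> Delta_arr" "mono_on {..tgt \<alpha>} \<sigma>" "\<sigma> ` {..tgt \<alpha>} \<subseteq> {0, 1}"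
  shows "app (circle \<alpha>) (circle_class (tgt \<alpha>) \<sigma>) = circle_class (src \<alpha>) (\<sigma> \<circ> app \<alpha>)"
proof -
  have \<alpha>: "app \<alpha> j \<le> tgt \<alpha>" if "j \<le> src \<alpha>" for j
    using assms(1) that by (auto simp: Delta_arr_def PiE_iff)
  have "circle_class (src \<alpha>) (interval_simplex (circle_class (tgt \<alpha>) \<sigma>) \<circ> app \<alpha>)
      = circle_class (src \<alpha>) (\<sigma> \<circ> app \<alpha>)"
  proof (cases "\<sigma> ` {..tgt \<alpha>} = {0, 1}")
    case True
    show ?thesis
      by (rule circle_class_cong) (simp add: interval_simplex_circle_class[OF assms(2) True] \<alpha>)
  next
    case False
    moreover have "(\<sigma> \<circ> app \<alpha>) ` {..src \<alpha>} \<subseteq> \<sigma> ` {..tgt \<alpha>}"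
      using \<alpha> by fastforce
    ultimately have "(\<sigma> \<circ> app \<alpha>) ` {..src \<alpha>} \<noteq> {0, 1}"
      using assms(3) by blast
    moreover have "(interval_simplex 0 \<circ> app \<alpha>) ` {..src \<alpha>} \<noteq> {0, 1}"
      by (auto simp: interval_simplex_def)
    ultimately show ?thesis using False by (simp add: circle_class_def)
  qed
  then show ?thesis by (simp add: circle_def circle_class_le)
qed

lemma circle_id: "circle (id_arr k) = id_arr k"
proof (rule app_ext)
  fix i assume "i \<le> src (circle (id_arr k))"
  then have i: "i \<le> k" by (simp add: circle_def id_arr_def)
  have "circle_class k (interval_simplex i \<circ> app (id_arr k)) = circle_class k (interval_simplex i)"
    by (rule circle_class_cong) (simp add: id_arr_def)
  then show "app (circle (id_arr k)) i = app (id_arr k) i"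
    using i circle_class_interval_simplex[OF i] by (simp add: circle_def id_arr_def)
qed (auto simp: circle_def id_arr_def)

lemma circle_comp:
  assumes "\<alpha> \<in> Delta_arr" "\<beta> \<in> Delta_arr" "tgt \<alpha> = src \<beta>"
  shows "circle (comp_arr \<beta> \<alpha>) = comp_arr (circle \<alpha>) (circle \<beta>)"
proof (rule app_ext)
  fix i assume "i \<le> src (circle (comp_arr \<beta> \<alpha>))"
  then have i: "i \<le> tgt \<beta>" by (simp add: circle_def comp_arr_def)
  define \<sigma> where "\<sigma> = interval_simplex i \<circ> app \<beta>"
  have "app \<beta> j \<le> app \<beta> j'" if "j \<le> j'" "j' \<le> src \<beta>" for j j'
    using mono_onD[of "{..src \<beta>}" "app \<beta>" j j'] assms(2) that by (simp add: Delta_arr_def)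
  then have "\<sigma> j \<le> \<sigma> j'" if "j \<le> j'" "j' \<le> src \<beta>" for j j'
    using that order_trans[of i "app \<beta> j" "app \<beta> j'"] by (simp add: \<sigma>_def interval_simplex_def)
  then have "mono_on {..tgt \<alpha>} \<sigma>"
    unfolding assms(3) by (intro mono_onI) simp
  moreover have "\<sigma> ` {..tgt \<alpha>} \<subseteq> {0, 1}" by (auto simp: \<sigma>_def interval_simplex_def)
  ultimately have "app (circle \<alpha>) (circle_class (tgt \<alpha>) \<sigma>) = circle_class (src \<alpha>) (\<sigma> \<circ> app \<alpha>)"
    by (rule circle_circle_class[OF assms(1)])
  also have "\<dots> = circle_class (src \<alpha>) (interval_simplex i \<circ> app (comp_arr \<beta> \<alpha>))"
    by (rule circle_class_cong) (simp add: \<sigma>_def comp_arr_def compose_def)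
  finally show "app (circle (comp_arr \<beta> \<alpha>)) i = app (comp_arr (circle \<alpha>) (circle \<beta>)) i"
    using i assms(3) by (simp add: circle_def \<sigma>_def comp_arr_def compose_def circle_class_le)
qed (auto simp: circle_def comp_arr_def compose_def)

lemma multi_module_F1: "multi_module 0 F1"
  by (auto simp: multi_module_def F1_def Fin_arr_def Delta_arrs_def id_arr_def comp_arr_def
      compose_def PiE_iff)

lemma multi_module_deloop:
  assumes "multi_module n X"
  shows "multi_module (Suc n) (deloop X)"
proof -
  have arrs: "\<exists>\<alpha>s' \<alpha>. \<alpha>s = \<alpha>s' @ [\<alpha>] \<and> \<alpha>s' \<in> Delta_arrs n \<and> \<alpha> \<in> Delta_arr"
    if "\<alpha>s \<in> Delta_arrs (Suc n)" for \<alpha>s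
    using that by (cases \<alpha>s rule: rev_cases) (auto simp: Delta_arrs_def)
  have degs: "\<exists>ks' k. ks = ks' @ [k] \<and> length ks' = n" if "length ks = Suc n" for ks :: "nat list"
    using that by (cases ks rule: rev_cases) auto
  have st: "src (smash f g) = src f * src g" "tgt (smash f g) = tgt f * tgt g"
    "src (circle \<alpha>) = tgt \<alpha>" "tgt (circle \<alpha>) = src \<alpha>" for f g \<alpha>
    by (simp_all add: smash_def circle_def)
  have base: "mbase X ks m \<in> mobj X ks m" if "length ks = n" for ks m
    using assms that by (simp add: multi_module_def)
  have maps: "mact X \<alpha>s f x \<in> mobj X (map src \<alpha>s) (tgt f)"
    if "\<alpha>s \<in> Delta_arrs n" "f \<in> Fin_arr" "x \<in> mobj X (map tgt \<alpha>s) (src f)" for \<alpha>s f x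
    using assms that unfolding multi_module_def by blast
  have act_base: "mact X \<alpha>s f (mbase X (map tgt \<alpha>s) (src f)) = mbase X (map src \<alpha>s) (tgt f)"
    if "\<alpha>s \<in> Delta_arrs n" "f \<in> Fin_arr" for \<alpha>s f
    using assms that unfolding multi_module_def by blast
  have act_id: "mact X (map id_arr ks) (id_arr m) x = x"
    if "length ks = n" "x \<in> mobj X ks m" for ks m x
    using assms that unfolding multi_module_def by blast
  have act_comp: "mact X (map2 comp_arr \<beta>s \<alpha>s) (comp_arr g f) x = mact X \<alpha>s g (mact X \<beta>s f x)"
    if "\<alpha>s \<in> Delta_arrs n" "\<beta>s \<in> Delta_arrs n" "f \<in> Fin_arr" "g \<in> Fin_arr"
      "map tgt \<alpha>s = map src \<beta>s" "tgt f = src g" "x \<in> mobj X (map tgt \<beta>s) (src f)" for \<alpha>s \<beta>s f g x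
    using assms that unfolding multi_module_def by blast
  have pointed: "mobj X ks 0 = {mbase X ks 0}" if "length ks = n" for ks
    using assms that by (simp add: multi_module_def)
  note sm = smash_Fin_arr[OF circle_Fin_arr]
  show ?thesis
    unfolding multi_module_def
  proof (intro conjI allI ballI impI)
    fix ks m assume "length (ks :: nat list) = Suc n"
    then show "mbase (deloop X) ks m \<in> mobj (deloop X) ks m"
      using degs by (fastforce simp: deloop_def base)
  next
    fix \<alpha>s f assume "\<alpha>s \<in> Delta_arrs (Suc n)" and f: "f \<in> Fin_arr"
    then obtain \<alpha>s' \<alpha> where \<alpha>: "\<alpha>s = \<alpha>s' @ [\<alpha>]" "\<alpha>s' \<in> Delta_arrs n" using arrs by blast
    show "mact (deloop X) \<alpha>s f
        \<in> mobj (deloop X) (map tgt \<alpha>s) (src f) \<rightarrow> mobj (deloop X) (map src \<alpha>s) (tgt f)"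
      using maps[OF \<alpha>(2) sm[OF f, of \<alpha>]] by (auto simp: deloop_def \<alpha>(1) st)
    show "mact (deloop X) \<alpha>s f (mbase (deloop X) (map tgt \<alpha>s) (src f))
        = mbase (deloop X) (map src \<alpha>s) (tgt f)"
      using act_base[OF \<alpha>(2) sm[OF f, of \<alpha>]] by (simp add: deloop_def \<alpha>(1) st)
  next
    fix ks m x assume "length (ks :: nat list) = Suc n" and x: "x \<in> mobj (deloop X) ks m"
    then obtain ks' k where "ks = ks' @ [k]" "length ks' = n" using degs by blast
    then show "mact (deloop X) (map id_arr ks) (id_arr m) x = x"
      using x by (simp add: deloop_def circle_id smash_id act_id)
  next
    fix \<alpha>s \<beta>s f g x
    assume as: "\<alpha>s \<in> Delta_arrs (Suc n)" "\<beta>s \<in> Delta_arrs (Suc n)"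
      and f: "f \<in> Fin_arr" and g: "g \<in> Fin_arr"
      and eq: "map tgt \<alpha>s = map src \<beta>s" "tgt f = src g"
      and x: "x \<in> mobj (deloop X) (map tgt \<beta>s) (src f)"
    obtain \<alpha>s' \<alpha> where \<alpha>: "\<alpha>s = \<alpha>s' @ [\<alpha>]" "\<alpha>s' \<in> Delta_arrs n" "\<alpha> \<in> Delta_arr"
      using arrs as by blast
    obtain \<beta>s' \<beta> where \<beta>: "\<beta>s = \<beta>s' @ [\<beta>]" "\<beta>s' \<in> Delta_arrs n" "\<beta> \<in> Delta_arr"
      using arrs as by blast
    have len: "length \<alpha>s' = length \<beta>s'" using \<alpha> \<beta> by (simp add: Delta_arrs_def)
    have eq': "map tgt \<alpha>s' = map src \<beta>s'" "tgt \<alpha> = src \<beta>" using eq \<alpha> \<beta> by auto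
    have "smash (circle (comp_arr \<beta> \<alpha>)) (comp_arr g f)
        = comp_arr (smash (circle \<alpha>) g) (smash (circle \<beta>) f)"
      using \<alpha> \<beta> eq eq' f g by (simp add: circle_comp smash_comp circle_Fin_arr st)
    then show "mact (deloop X) (map2 comp_arr \<beta>s \<alpha>s) (comp_arr g f) x
        = mact (deloop X) \<alpha>s g (mact (deloop X) \<beta>s f x)"
      using act_comp[OF \<alpha>(2) \<beta>(2) sm[OF f, of \<beta>] sm[OF g, of \<alpha>] eq'(1)] x eq eq'(2) len
      by (simp add: deloop_def \<alpha>(1) \<beta>(1) st)
  next
    fix ks assume "length (ks :: nat list) = Suc n"
    then show "mobj (deloop X) ks 0 = {mbase (deloop X) ks 0}"
      using degs by (fastforce simp: deloop_def pointed)
  qed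
qed

lemma multi_module_deloop_F1: "multi_module n ((deloop ^^ n) F1)"
  by (induction n) (simp_all add: multi_module_F1 multi_module_deloop)

lemma multi_sset_eval_at:
  assumes "multi_module n X"
  shows "multi_sset n (eval_at X m)"
proof -
  have id: "src (id_arr m) = m" "tgt (id_arr m) = m" "comp_arr (id_arr m) (id_arr m) = id_arr m"
    by (auto simp: id_arr_def comp_arr_def compose_def)
  have "mact X \<alpha>s (id_arr m) \<in> mobj X (map tgt \<alpha>s) m \<rightarrow> mobj X (map src \<alpha>s) m"
    "mact X \<alpha>s (id_arr m) (mbase X (map tgt \<alpha>s) m) = mbase X (map src \<alpha>s) m"
    if "\<alpha>s \<in> Delta_arrs n" for \<alpha>s
    using assms that id_Fin_arr[of m] unfolding multi_module_def by (metis id(1,2))+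
  moreover have "mact X (map2 comp_arr \<beta>s \<alpha>s) (id_arr m) x
      = mact X \<alpha>s (id_arr m) (mact X \<beta>s (id_arr m) x)"
    if "\<alpha>s \<in> Delta_arrs n" "\<beta>s \<in> Delta_arrs n" "map tgt \<alpha>s = map src \<beta>s"
      "x \<in> mobj X (map tgt \<beta>s) m" for \<alpha>s \<beta>s x
    using assms that id_Fin_arr[of m] unfolding multi_module_def by (metis id)
  moreover have "mbase X ks m \<in> mobj X ks m"
    "\<forall>x\<in>mobj X ks m. mact X (map id_arr ks) (id_arr m) x = x" if "length ks = n" for ks
    using assms that by (simp_all add: multi_module_def)
  ultimately show ?thesis by (simp add: multi_sset_def eval_at_def)
qed

end

theory Submission
  imports Defs
begin

text \<open>
  The simplices of multidegree \<open>[k\<^sub>1, \<dots>, k\<^sub>n]\<close> of the \<open>n\<close>-fold delooping of \<open>F1\<close>, evaluated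
  at \<open>\<langle>1\<rangle>\<close>, are the elements of \<open>\<langle>k\<^sub>1\<rangle> \<and> \<dots> \<and> \<langle>k\<^sub>n\<rangle>\<close>: the delooping is the external smash
  product of \<open>n\<close> simplicial circles \<open>\<Delta>\<^sup>1/\<partial>\<Delta>\<^sup>1\<close>. Its only nondegenerate simplices are the basepoint
  in multidegree \<open>[0, \<dots>, 0]\<close> and one simplex in multidegree \<open>[1, \<dots>, 1]\<close>, so the realization should
  be the cube \<open>|\<Delta>\<^sup>1|\<^sup>n = [0, 1]\<^sup>n\<close> with its boundary collapsed to the basepoint, which for \<open>n = 0\<close> is
  an additional point.

  The proof makes this explicit by a function \<open>sphere_point\<close> on the disjoint union
  \<open>realization_sum\<close>. A simplex \<open>i\<^sub>1 \<and> \<dots> \<and> i\<^sub>n\<close> with all \<open>i\<^sub>j \<ge> 1\<close> corresponds to the monotone maps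
  \<open>interval_simplex i\<^sub>j : [k\<^sub>j] \<rightarrow> [1]\<close>, and these send the product of the \<open>|\<Delta>[k\<^sub>j]|\<close> to the cube; the map
  \<open>cube_to_disc\<close> leads on to the disc, whose boundary is collapsed. The basepoint simplices go to
  the basepoint.

  Two facts then suffice. First, \<open>sphere_point\<close> identifies precisely the points which are
  equivalent in the coend. It respects the generating relations (\<open>sphere_point_glue\<close>), and
  conversely every point is equivalent to a normal form that its image determines
  (\<open>sphere_point_eq_imp_coend_equiv\<close>). Second, the collapsed disc carries the final topology of
  \<open>sphere_point\<close> (\<open>final_topology_sphere_point\<close>), because \<open>[0, 1]\<^sup>n \<rightarrow> D\<^sup>n\<close> is a continuous surjection
  of compact Hausdorff spaces. So the realization and the collapsed disc are quotients of the same
  space with the same fibres (\<open>homeomorphic_final_topologies\<close>).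
\<close>

section \<open>Quotients with the same fibres\<close>

text \<open>
  A quotient is determined by its fibres, so that comparing two quotients of one space amounts to
  comparing which points they identify.
\<close>

lemma homeomorphic_final_topologies:
  assumes p: "p ` topspace T = P" and q: "q ` topspace T = Q"
    and fibres: "\<And>x y. x \<in> topspace T \<Longrightarrow> y \<in> topspace T \<Longrightarrow> p x = p y \<longleftrightarrow> q x = q y"
  shows "final_topology P T p homeomorphic_space final_topology Q T q"
proof -
  define h where "h z = q (SOME x. x \<in> topspace T \<and> p x = z)" for z
  have h: "h (p x) = q x" if "x \<in> topspace T" for x
  proof -
    have "\<exists>y. y \<in> topspace T \<and> p y = p x" using that by blast
    from someI_ex[OF this] show ?thesis unfolding h_def using fibres that by blast
  qed
  have top: "topspace (final_topology P T p) = P" "topspace (final_topology Q T q) = Q"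
    using p q by (auto intro!: topspace_final_topology)
  have "openin (final_topology P T p) {z \<in> P. h z \<in> U} \<longleftrightarrow> openin (final_topology Q T q) U"
    if "U \<subseteq> Q" for U
  proof -
    have "{x \<in> topspace T. p x \<in> {z \<in> P. h z \<in> U}} = {x \<in> topspace T. q x \<in> U}"
      unfolding p[symmetric] using h by (auto simp: fibres)
    then show ?thesis using that by (simp add: openin_final_topology)
  qed
  moreover have "h ` P = Q" using h p q by (auto simp: image_iff)
  moreover have "inj_on h P" using h p fibres by (auto simp: inj_on_def)
  ultimately have "homeomorphic_map (final_topology P T p) (final_topology Q T q) h"
    by (simp add: homeomorphic_map_def quotient_map_def top)
  then show ?thesis by (rule homeomorphic_map_imp_homeomorphic_space)
qed

section \<open>The disc as a quotient of the cube\<close>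

text \<open>
  The parametrization of a hemisphere by angles, projected to the disc, with the sine of each angle
  as parameter: the \<open>j\<close>-th entry is scaled by the radius that the earlier entries leave over.
\<close>

definition cube_to_disc :: "nat \<Rightarrow> (nat \<Rightarrow> real) \<Rightarrow> (nat \<Rightarrow> real)" where
  "cube_to_disc n x = (\<lambda>j. if j < n then x j * (\<Prod>i<j. sqrt (1 - (x i)\<^sup>2)) else 0)"

lemma cube_to_disc_cong:
  assumes "\<And>i. i < n \<Longrightarrow> x i = y i"
  shows "cube_to_disc n x = cube_to_disc n y"
  using assms by (auto simp: cube_to_disc_def fun_eq_iff)

text \<open>
  Each new entry multiplies the remaining squared radius by \<open>1 - (x j)\<^sup>2\<close>. Since the right hand side
  vanishes iff some \<open>x j\<close> is \<open>1\<close> or \<open>-1\<close>, the boundary of the cube is exactly what goes to the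
  boundary of the disc.
\<close>

lemma cube_to_disc_defect:
  assumes "\<And>i. i < n \<Longrightarrow> \<bar>x i\<bar> \<le> 1"
  shows "1 - (\<Sum>j<n. (cube_to_disc n x j)\<^sup>2) = (\<Prod>i<n. 1 - (x i)\<^sup>2)"
proof -
  have "1 - (\<Sum>j<m. (x j * (\<Prod>i<j. sqrt (1 - (x i)\<^sup>2)))\<^sup>2) = (\<Prod>i<m. 1 - (x i)\<^sup>2)" if "m \<le> n" for m
    using that
  proof (induction m)
    case (Suc m)
    have "(\<Prod>i<m. sqrt (1 - (x i)\<^sup>2))\<^sup>2 = (\<Prod>i<m. 1 - (x i)\<^sup>2)"
      unfolding prod_power_distrib
      by (rule prod.cong) (use Suc.prems assms in \<open>auto simp: abs_square_le_1\<close>)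
    then show ?case using Suc by (simp add: power_mult_distrib algebra_simps)
  qed simp
  from this[of n] show ?thesis by (simp add: cube_to_disc_def)
qed

lemma cube_to_disc_in_disc:
  assumes "\<And>i. i < n \<Longrightarrow> \<bar>x i\<bar> \<le> 1"
  shows "cube_to_disc n x \<in> topspace (disc n)"
proof -
  have "(\<Prod>i<n. 1 - (x i)\<^sup>2) \<ge> 0" by (rule prod_nonneg) (use assms in \<open>auto simp: abs_square_le_1\<close>)
  then show ?thesis using cube_to_disc_defect[of n x] assms
    by (simp add: disc_def topspace_Euclidean_space) (simp add: cube_to_disc_def)
qed

lemma cube_to_disc_boundary_iff:
  assumes "\<And>i. i < n \<Longrightarrow> \<bar>x i\<bar> \<le> 1"
  shows "cube_to_disc n x \<in> disc_boundary n \<longleftrightarrow> (\<exists>i<n. \<bar>x i\<bar> = 1)"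
proof -
  have "cube_to_disc n x \<in> disc_boundary n \<longleftrightarrow> (\<Prod>i<n. 1 - (x i)\<^sup>2) = 0"
  proof -
    have "cube_to_disc n x \<in> disc_boundary n \<longleftrightarrow> 1 - (\<Sum>j<n. (cube_to_disc n x j)\<^sup>2) = 0"
      using cube_to_disc_in_disc[of n x] assms by (auto simp: disc_boundary_def)
    then show ?thesis using cube_to_disc_defect[of n x] assms by simp
  qed
  also have "\<dots> \<longleftrightarrow> (\<exists>i<n. \<bar>x i\<bar> = 1)"
    by (auto simp: abs_square_eq_1)
  finally show ?thesis .
qed

text \<open>
  In the interior of the cube all scaling factors are nonzero, so the entries can be recovered one
  after the other.
\<close>

lemma cube_to_disc_inject:
  assumes "\<And>i. i < n \<Longrightarrow> \<bar>x i\<bar> < 1" "cube_to_disc n x = cube_to_disc n y" "i < n"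
  shows "x i = y i"
  using assms(3)
proof (induction i rule: less_induct)
  case (less i)
  have "x i * (\<Prod>l<i. sqrt (1 - (x l)\<^sup>2)) = y i * (\<Prod>l<i. sqrt (1 - (y l)\<^sup>2))"
    using assms(2) less.prems by (auto simp: cube_to_disc_def dest: fun_cong[of _ _ i])
  also have "(\<Prod>l<i. sqrt (1 - (y l)\<^sup>2)) = (\<Prod>l<i. sqrt (1 - (x l)\<^sup>2))"
    by (rule prod.cong) (use less in auto)
  finally have "x i * (\<Prod>l<i. sqrt (1 - (x l)\<^sup>2)) = y i * (\<Prod>l<i. sqrt (1 - (x l)\<^sup>2))" .
  moreover have "(\<Prod>l<i. sqrt (1 - (x l)\<^sup>2)) \<noteq> 0"
  proof -
    have "(x l)\<^sup>2 \<noteq> 1" if "l < i" for l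
      using assms(1)[of l] less.prems that by (simp add: abs_square_eq_1)
    then show ?thesis by auto
  qed
  ultimately show ?case by simp
qed

lemma cube_to_disc_surj:
  assumes "y \<in> topspace (disc n)"
  obtains x where "\<And>i. i < n \<Longrightarrow> \<bar>x i\<bar> \<le> 1" "cube_to_disc n x = y"
proof -
  \<comment> \<open>\<open>s j\<close> is the squared radius left over by the entries of \<open>y\<close> before \<open>j\<close>.\<close>
  define s where "s j = 1 - (\<Sum>i<j. (y i)\<^sup>2)" for j
  \<comment> \<open>Once \<open>s j = 0\<close>, all later entries of \<open>y\<close> are zero, and so is \<open>x j\<close>, as division by zero gives zero.\<close>
  define x where "x j = y j / sqrt (s j)" for j
  have y: "(\<Sum>i<n. (y i)\<^sup>2) \<le> 1" "\<And>j. j \<ge> n \<Longrightarrow> y j = 0"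
    using assms by (auto simp: disc_def topspace_Euclidean_space)
  have s_nonneg: "s j \<ge> 0" if "j \<le> n" for j
    using y sum_mono2[of "{..<n}" "{..<j}" "\<lambda>i. (y i)\<^sup>2"] that by (auto simp: s_def)
  have s_Suc: "s (Suc j) = s j - (y j)\<^sup>2" for j by (simp add: s_def)
  have y0: "y j = 0" if "j < n" "s j = 0" for j
    using s_nonneg[of "Suc j"] that by (simp add: s_Suc)
  have s_step: "s (Suc j) = s j * (1 - (x j)\<^sup>2)" if "j < n" for j
    using y0[OF that] s_nonneg[of j] that
    by (cases "s j = 0") (simp_all add: s_Suc x_def power_divide field_simps)
  have x_le: "\<bar>x j\<bar> \<le> 1" if j: "j < n" for j
  proof (cases "s j = 0")
    case False
    then have "s j > 0" using s_nonneg[of j] j by simp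
    moreover have "s j * (1 - (x j)\<^sup>2) \<ge> 0" using s_step[OF j] s_nonneg[of "Suc j"] j by simp
    ultimately have "(x j)\<^sup>2 \<le> 1" by (simp add: zero_le_mult_iff)
    then show ?thesis by (simp add: abs_square_le_1)
  qed (simp add: x_def)
  have "(\<Prod>i<j. 1 - (x i)\<^sup>2) = s j" if "j \<le> n" for j
    using that by (induction j) (auto simp: s_step, simp add: s_def)
  moreover have "sqrt (\<Prod>i<j. 1 - (x i)\<^sup>2) = (\<Prod>i<j. sqrt (1 - (x i)\<^sup>2))" for j
    by (induction j) (auto simp: real_sqrt_mult)
  ultimately have prod_sqrt: "(\<Prod>i<j. sqrt (1 - (x i)\<^sup>2)) = sqrt (s j)" if "j \<le> n" for j
    using that by metis
  have "cube_to_disc n x j = y j" for j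
    using y0[of j] y(2)[of j] s_nonneg[of j]
    by (cases "s j = 0") (auto simp: cube_to_disc_def prod_sqrt, simp_all add: x_def)
  then show ?thesis using that x_le by blast
qed

section \<open>The simplices of the iterated delooping\<close>

text \<open>
  The element \<open>i\<^sub>1 \<and> \<dots> \<and> i\<^sub>n\<close> of \<open>\<langle>k\<^sub>1\<rangle> \<and> \<dots> \<and> \<langle>k\<^sub>n\<rangle> \<and> \<langle>1\<rangle>\<close>, bracketed to the right as
  the iterated delooping does it, with the non-basepoint \<open>1\<close> of \<open>\<langle>1\<rangle>\<close> as innermost factor. The
  function \<open>decode\<close> below is its inverse on non-basepoints.
\<close>

fun encode :: "nat list \<Rightarrow> nat list \<Rightarrow> nat" where
  "encode (k # ks) (i # is) = lex_pair (prod_list ks) i (encode ks is)"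
| "encode _ _ = 1"

primrec decode :: "nat list \<Rightarrow> nat \<Rightarrow> nat list" where
  "decode [] x = []"
| "decode (k # ks) x =
    Suc ((x - 1) div prod_list ks) # decode ks (Suc ((x - 1) mod prod_list ks))"

definition interior_index :: "nat list \<Rightarrow> nat list \<Rightarrow> bool" where
  "interior_index ks is \<longleftrightarrow> list_all2 (\<lambda>k i. 1 \<le> i \<and> i \<le> k) ks is"

lemma decode_encode:
  assumes "interior_index ks is"
  shows "1 \<le> encode ks is \<and> encode ks is \<le> prod_list ks \<and> decode ks (encode ks is) = is"
  using assms unfolding interior_index_def
proof (induction rule: list_all2_induct)
  case (Cons k ks i "is")
  define P where "P = prod_list ks"
  obtain i' x' where i': "i = Suc i'" and x': "encode ks is = Suc x'" "x' < P"
    using Cons P_def by (metis One_nat_def Suc_le_D Suc_le_eq)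
  have "lex_pair P i (Suc x') \<le> k * P" using Cons x' by (intro lex_pair_le) auto
  moreover have "(i' * P + x') div P = i'" "(i' * P + x') mod P = x'" using x' by auto
  moreover have "lex_pair P i (Suc x') = Suc (i' * P + x')" using i' by (simp add: lex_pair_def)
  ultimately show ?case using Cons x' i' by (simp flip: P_def)
qed simp

lemma encode_decode:
  assumes "1 \<le> x" "x \<le> prod_list ks"
  shows "interior_index ks (decode ks x) \<and> encode ks (decode ks x) = x"
  using assms
proof (induction ks arbitrary: x)
  case (Cons k ks)
  define P where "P = prod_list ks"
  have x: "x - 1 < k * P" using Cons.prems by (simp add: P_def)
  then have P: "P > 0" by (cases P) auto
  have "(x - 1) div P < k" using x by (simp add: less_mult_imp_div_less)
  moreover have "(x - 1) mod P < P" using P by simp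
  ultimately show ?case
    using Cons.IH[of "Suc ((x - 1) mod P)"] Cons.prems
    by (simp add: interior_index_def lex_pair_def flip: P_def)
qed (simp add: interior_index_def)

lemma encode_eq_0:
  assumes "length ks = length is" "0 \<in> set is"
  shows "encode ks is = 0"
  using assms by (induction rule: list_induct2) (auto simp: lex_pair_def)

lemma interior_index_nth:
  "interior_index ks is \<longleftrightarrow>
    length ks = length is \<and> (\<forall>j<length ks. 1 \<le> is ! j \<and> is ! j \<le> ks ! j)"
  by (auto simp: interior_index_def list_all2_conv_all_nth)

text \<open>
  A multisimplicial operator \<open>\<alpha>s\<close> acts on the iterated delooping of \<open>F1\<close> through the pointed map
  \<open>circle \<alpha>\<^sub>1 \<and> (\<dots> \<and> (circle \<alpha>\<^sub>n \<and> f))\<close>.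
\<close>

definition smash_circles :: "arr list \<Rightarrow> arr \<Rightarrow> arr" where
  "smash_circles \<alpha>s f = foldr (\<lambda>\<alpha>. smash (circle \<alpha>)) \<alpha>s f"

lemma smash_circles_Fin_arr:
  assumes "f \<in> Fin_arr"
  shows "smash_circles \<alpha>s f \<in> Fin_arr"
  using assms by (induction \<alpha>s) (auto simp: smash_circles_def smash_Fin_arr circle_Fin_arr)

lemma src_tgt_smash_circles:
  "src (smash_circles \<alpha>s f) = prod_list (map tgt \<alpha>s) * src f"
  "tgt (smash_circles \<alpha>s f) = prod_list (map src \<alpha>s) * tgt f"
  by (induction \<alpha>s) (auto simp: smash_circles_def smash_def circle_def)

lemma encode_le:
  assumes "list_all2 (\<le>) is ks"
  shows "encode ks is \<le> prod_list ks"
  using assms by (induction rule: list_all2_induct) (auto intro: lex_pair_le)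

lemma app_smash_circles:
  assumes "list_all2 (\<le>) is (map tgt \<alpha>s)"
  shows "app (smash_circles \<alpha>s (id_arr 1)) (encode (map tgt \<alpha>s) is)
    = encode (map src \<alpha>s) (map2 (\<lambda>\<alpha>. app (circle \<alpha>)) \<alpha>s is)"
  using assms
proof (induction \<alpha>s arbitrary: "is")
  case (Cons \<alpha> \<alpha>s)
  then obtain i js where ijs: "is = i # js" "i \<le> tgt \<alpha>" "list_all2 (\<le>) js (map tgt \<alpha>s)"
    by (auto simp: list_all2_Cons2)
  define g where "g = smash_circles \<alpha>s (id_arr 1)"
  have g: "g \<in> Fin_arr" "src g = prod_list (map tgt \<alpha>s)" "tgt g = prod_list (map src \<alpha>s)"
    by (simp_all add: g_def smash_circles_Fin_arr id_Fin_arr src_tgt_smash_circles)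
      (simp_all add: id_arr_def)
  have IH: "app g (encode (map tgt \<alpha>s) js)
      = encode (map src \<alpha>s) (map2 (\<lambda>\<alpha>. app (circle \<alpha>)) \<alpha>s js)"
    unfolding g_def by (rule Cons.IH[OF ijs(3)])
  have st: "src (circle \<alpha>) = tgt \<alpha>" "tgt (circle \<alpha>) = src \<alpha>" by (simp_all add: circle_def)
  have "smash_circles (\<alpha> # \<alpha>s) (id_arr 1) = smash (circle \<alpha>) g"
    by (simp add: g_def smash_circles_def)
  then show ?case
    using smash_lex_pair[OF circle_Fin_arr g(1), of i \<alpha> "encode (map tgt \<alpha>s) js"]
      IH st ijs encode_le[OF ijs(3)] g by simp
qed (simp add: smash_circles_def id_arr_def)

abbreviation sphere_sset :: "nat \<Rightarrow> nat multi_sset" where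
  "sphere_sset n \<equiv> eval_at ((deloop ^^ n) F1) 1"

text \<open>
  The list \<open>\<alpha>s\<close> is peeled off from its end, because the outermost delooping acts on the last
  simplicial direction; this puts its circle innermost.
\<close>

lemma deloop_power_F1:
  "mobj ((deloop ^^ n) F1) ks m = {..prod_list ks * m}" 
  "mact ((deloop ^^ n) F1) \<alpha>s = app \<circ> smash_circles \<alpha>s"
  if "length ks = n" "length \<alpha>s = n" for ks \<alpha>s
  using that
proof (induction n arbitrary: ks m \<alpha>s)
  case 0
  case 1
  then show ?case by (simp add: F1_def)
next
  case 0
  case 2
  then show ?case by (simp add: F1_def smash_circles_def fun_eq_iff)
next
  case (Suc n)
  case 1
  then show ?case using Suc(1)[of "butlast ks" "butlast \<alpha>s"]
    by (cases ks rule: rev_cases) (simp_all add: deloop_def mult.assoc)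
next
  case (Suc n)
  case 2
  then show ?case using Suc(2)[of "butlast ks" "butlast \<alpha>s"]
    by (cases \<alpha>s rule: rev_cases) (simp_all add: deloop_def smash_circles_def fun_eq_iff)
qed

lemma cells_sphere_sset:
  assumes "length ks = n"
  shows "cells (sphere_sset n) ks = {..prod_list ks}"
  using deloop_power_F1(1)[OF assms, of "replicate n undefined" 1] by (simp add: eval_at_def)

lemma act_sphere_sset:
  assumes "length \<alpha>s = n"
  shows "act (sphere_sset n) \<alpha>s = app (smash_circles \<alpha>s (id_arr 1))"
  using deloop_power_F1(2)[of "replicate n undefined" n \<alpha>s] assms by (simp add: eval_at_def)

lemma act_sphere_sset_0:
  assumes "length \<alpha>s = n"
  shows "act (sphere_sset n) \<alpha>s 0 = 0"
  using smash_circles_Fin_arr[OF id_Fin_arr, of \<alpha>s 1] assms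
  unfolding act_sphere_sset[OF assms] Fin_arr_def by blast

lemma act_sphere_sset_encode:
  assumes "length \<alpha>s = n" "interior_index (map tgt \<alpha>s) is"
  shows "act (sphere_sset n) \<alpha>s (encode (map tgt \<alpha>s) is)
    = encode (map src \<alpha>s) (map2 (\<lambda>\<alpha>. app (circle \<alpha>)) \<alpha>s is)"
proof -
  have "list_all2 (\<le>) is (map tgt \<alpha>s)"
    using assms by (auto simp: interior_index_nth list_all2_conv_all_nth)
  from app_smash_circles[OF this] show ?thesis unfolding act_sphere_sset[OF assms(1)] .
qed

section \<open>From the realization to the collapsed disc\<close>

text \<open>
  For \<open>i \<ge> 1\<close>, the \<open>k\<close>-simplex \<open>i\<close> of the circle is the class of \<open>interval_simplex i : [k] \<rightarrow> [1]\<close>.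
  The affine map \<open>|\<Delta>\<^sup>k| \<rightarrow> |\<Delta>\<^sup>1| = [0, 1]\<close> which that monotone map induces is \<open>tail_mass k i\<close>.
\<close>

definition tail_mass :: "nat \<Rightarrow> nat \<Rightarrow> (nat \<Rightarrow> real) \<Rightarrow> real" where
  "tail_mass k i t = (\<Sum>l=i..k. t l)"

lemma tail_mass_0:
  assumes "t \<in> standard_simplex k"
  shows "tail_mass k 0 t = 1"
  using assms by (simp add: tail_mass_def standard_simplex_def atLeast0AtMost)

lemma tail_mass_bounds:
  assumes "t \<in> standard_simplex k"
  shows "0 \<le> tail_mass k i t" "tail_mass k i t \<le> 1"
proof -
  have t: "t l \<ge> 0" for l using assms by (simp add: standard_simplex_def)
  then show "0 \<le> tail_mass k i t" by (simp add: tail_mass_def sum_nonneg)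
  have "tail_mass k i t \<le> tail_mass k 0 t"
    unfolding tail_mass_def by (rule sum_mono2) (auto simp: t)
  then show "tail_mass k i t \<le> 1" using assms by (simp add: tail_mass_0)
qed

lemma tail_mass_simplex_map:
  assumes "\<alpha> \<in> Delta_arr"
  shows "tail_mass (tgt \<alpha>) i (simplex_map \<alpha> t) = (\<Sum>l | l \<le> src \<alpha> \<and> i \<le> app \<alpha> l. t l)"
proof -
  have "tail_mass (tgt \<alpha>) i (simplex_map \<alpha> t)
      = (\<Sum>j=i..tgt \<alpha>. \<Sum>l \<in> {l \<in> {l. l \<le> src \<alpha> \<and> i \<le> app \<alpha> l}. app \<alpha> l = j}. t l)"
    unfolding tail_mass_def simplex_map_def by (intro sum.cong) auto
  also have "\<dots> = (\<Sum>l | l \<le> src \<alpha> \<and> i \<le> app \<alpha> l. t l)"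
    by (rule sum.group) (use assms in \<open>auto simp: Delta_arr_def PiE_iff\<close>)
  finally show ?thesis .
qed

text \<open>
  Pulling back \<open>interval_simplex i\<close> along \<open>\<alpha>\<close> gives either a constant map, which lies in the boundary
  of the interval and hence is the basepoint, or again the cut at \<open>circle \<alpha> i\<close>.
\<close>

lemma app_circle_cases:
  assumes "\<alpha> \<in> Delta_arr" "i \<le> tgt \<alpha>"
  obtains (const) "app (circle \<alpha>) i = 0"
      "(\<forall>l\<le>src \<alpha>. i \<le> app \<alpha> l) \<or> (\<forall>l\<le>src \<alpha>. \<not> i \<le> app \<alpha> l)"
  | (cut) "1 \<le> app (circle \<alpha>) i" "app (circle \<alpha>) i \<le> src \<alpha>"
      "\<And>l. l \<le> src \<alpha> \<Longrightarrow> i \<le> app \<alpha> l \<longleftrightarrow> app (circle \<alpha>) i \<le> l"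
proof -
  define \<sigma> where "\<sigma> = interval_simplex i \<circ> app \<alpha>"
  have c: "app (circle \<alpha>) i = circle_class (src \<alpha>) \<sigma>"
    using assms by (simp add: circle_def \<sigma>_def)
  have \<sigma>: "\<sigma> l = (if i \<le> app \<alpha> l then 1 else 0)" for l
    by (simp add: \<sigma>_def interval_simplex_def)
  have mono: "mono_on {..src \<alpha>} \<sigma>"
  proof (rule mono_onI)
    fix l m assume "l \<in> {..src \<alpha>}" "m \<in> {..src \<alpha>}" "l \<le> m"
    then have "app \<alpha> l \<le> app \<alpha> m" using assms(1) mono_onD by (fastforce simp: Delta_arr_def)
    then show "\<sigma> l \<le> \<sigma> m" by (auto simp: \<sigma>)
  qed
  show ?thesis
  proof (cases "\<sigma> ` {..src \<alpha>} = {0, 1}")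
    case True
    have *: "i \<le> app \<alpha> l \<longleftrightarrow> app (circle \<alpha>) i \<le> l" if "l \<le> src \<alpha>" for l
      using interval_simplex_circle_class[OF mono True that]
      by (auto simp: c \<sigma> interval_simplex_def split: if_splits)
    have "0 \<in> \<sigma> ` {..src \<alpha>}" using True by simp
    then obtain l where "l \<le> src \<alpha>" "\<not> i \<le> app \<alpha> l" by (auto simp: \<sigma> split: if_splits)
    then have "app (circle \<alpha>) i \<noteq> 0" using * by auto
    then show ?thesis using cut * circle_class_le[of "src \<alpha>" \<sigma>] c by auto
  next
    case False
    then have "app (circle \<alpha>) i = 0" unfolding c by (simp add: circle_class_def)
    moreover have "(\<forall>l\<le>src \<alpha>. i \<le> app \<alpha> l) \<or> (\<forall>l\<le>src \<alpha>. \<not> i \<le> app \<alpha> l)"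
    proof (rule ccontr)
      assume "\<not> ?thesis"
      then obtain l m where "l \<le> src \<alpha>" "\<sigma> l = 0" "m \<le> src \<alpha>" "\<sigma> m = 1" by (auto simp: \<sigma>)
      then have "{0, 1} \<subseteq> \<sigma> ` {..src \<alpha>}" by (auto simp: image_iff) (metis atMost_iff)+
      then show False using False by (auto simp: \<sigma>)
    qed
    ultimately show ?thesis by (rule const)
  qed
qed

text \<open>
  The compatibility with the coend relation in a single simplicial direction: up to the
  identification of the end points of \<open>[0, 1]\<close> with the basepoint, \<open>tail_mass\<close> is invariant under moving an
  operator from the point of the simplex to the simplex of the circle.
\<close>

lemma tail_mass_circle:
  assumes "\<alpha> \<in> Delta_arr" "i \<le> tgt \<alpha>" "t \<in> standard_simplex (src \<alpha>)"
  shows "if app (circle \<alpha>) i = 0 then tail_mass (tgt \<alpha>) i (simplex_map \<alpha> t) \<in> {0, 1}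
    else tail_mass (tgt \<alpha>) i (simplex_map \<alpha> t) = tail_mass (src \<alpha>) (app (circle \<alpha>) i) t"
  using assms(1,2)
proof (cases rule: app_circle_cases)
  case const
  have "(\<Sum>l | l \<le> src \<alpha>. t l) = 1"
    using assms(3) by (simp add: standard_simplex_def atMost_def)
  with const show ?thesis
    by (auto simp: tail_mass_simplex_map[OF assms(1)] conj_commute cong: conj_cong)
next
  case cut
  then have "{l. l \<le> src \<alpha> \<and> i \<le> app \<alpha> l} = {app (circle \<alpha>) i..src \<alpha>}" by auto
  then show ?thesis using cut(1) by (simp add: tail_mass_simplex_map[OF assms(1)]) (simp add: tail_mass_def)
qed

text \<open>
  The map \<open>[0, 1]\<^sup>n \<rightarrow> D\<^sup>n/\<partial>D\<^sup>n\<close> that collapses exactly the boundary of the cube.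
\<close>

definition pinch :: "nat \<Rightarrow> (nat \<Rightarrow> real) \<Rightarrow> (nat \<Rightarrow> real) option" where
  "pinch n u = (let y = cube_to_disc n (\<lambda>j. 2 * u j - 1) in
     if y \<in> disc_boundary n then None else Some y)"

lemma pinch_eq_None_iff:
  assumes "\<And>j. j < n \<Longrightarrow> 0 \<le> u j \<and> u j \<le> 1"
  shows "pinch n u = None \<longleftrightarrow> (\<exists>j<n. u j \<in> {0, 1})"
proof -
  have "\<bar>2 * u j - 1\<bar> \<le> 1" "\<bar>2 * u j - 1\<bar> = 1 \<longleftrightarrow> u j \<in> {0, 1}" if "j < n" for j
    using assms[OF that] by auto
  then show ?thesis by (auto simp: pinch_def Let_def cube_to_disc_boundary_iff)
qed

lemma pinch_cong:
  assumes "\<And>j. j < n \<Longrightarrow> u j = v j"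
  shows "pinch n u = pinch n v"
proof -
  have "cube_to_disc n (\<lambda>j. 2 * u j - 1) = cube_to_disc n (\<lambda>j. 2 * v j - 1)"
    by (rule cube_to_disc_cong) (simp add: assms)
  then show ?thesis by (simp add: pinch_def)
qed

lemma pinch_inject:
  assumes "\<And>j. j < n \<Longrightarrow> 0 \<le> u j \<and> u j \<le> 1" "pinch n u = pinch n v" "pinch n u \<noteq> None" "j < n"
  shows "u j = v j"
proof -
  have "\<not> (\<exists>j<n. u j \<in> {0, 1})" using assms(3) pinch_eq_None_iff[of n u, OF assms(1)] by simp
  then have "\<bar>2 * u j - 1\<bar> < 1" if "j < n" for j
    using assms(1)[OF that] that by (force simp: abs_less_iff)
  moreover have "cube_to_disc n (\<lambda>j. 2 * u j - 1) = cube_to_disc n (\<lambda>j. 2 * v j - 1)"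
    using assms(2,3) by (auto simp: pinch_def Let_def split: if_splits)
  ultimately have "2 * u j - 1 = 2 * v j - 1" using assms(4) by (rule cube_to_disc_inject)
  then show ?thesis by simp
qed

text \<open>
  The basepoint simplex \<open>x = 0\<close> has to be treated separately, since \<open>decode\<close> is meaningful only for
  \<open>x \<ge> 1\<close>. For \<open>n = 0\<close> this case alone produces the basepoint, as \<open>disc_boundary 0\<close> is empty.
\<close>

definition sphere_point ::
    "nat \<Rightarrow> nat list \<times> nat \<times> (nat \<Rightarrow> nat \<Rightarrow> real) \<Rightarrow> (nat \<Rightarrow> real) option" where
  "sphere_point n = (\<lambda>(ks, x, t). if x = 0 then None
     else pinch n (\<lambda>j. tail_mass (ks ! j) (decode ks x ! j) (t j)))"

lemma sphere_point_0: "sphere_point n (ks, 0, t) = None"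
  by (simp add: sphere_point_def)

lemma sphere_point_encode:
  assumes "interior_index ks is"
  shows "sphere_point n (ks, encode ks is, t) = pinch n (\<lambda>j. tail_mass (ks ! j) (is ! j) (t j))"
  using decode_encode[OF assms] by (auto simp: sphere_point_def)

lemma topspace_simplex_product:
  "topspace (simplex_product ks) = (\<Pi>\<^sub>E j\<in>{..<length ks}. standard_simplex (ks ! j))"
  by (simp add: simplex_product_def topspace_standard_simplex)

lemma topspace_realization_sum:
  "topspace (realization_sum n X)
    = {(ks, x, t). length ks = n \<and> x \<in> cells X ks \<and> t \<in> topspace (simplex_product ks)}"
  by (auto simp: realization_sum_def)

text \<open>
  Let \<open>x\<close> be a simplex other than the basepoint. If \<open>\<alpha>s\<close> keeps all its indices away from the
  basepoint, then both sides have the same coordinates in the cube. Otherwise the left simplex is the basepoint, while on the right some coordinate is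
  \<open>0\<close> or \<open>1\<close>, so that the point is on the collapsed boundary.
\<close>

lemma sphere_point_glue:
  assumes \<alpha>s: "\<alpha>s \<in> Delta_arrs n" and x: "x \<in> cells (sphere_sset n) (map tgt \<alpha>s)"
    and t: "t \<in> topspace (simplex_product (map src \<alpha>s))"
  shows "sphere_point n (map src \<alpha>s, act (sphere_sset n) \<alpha>s x, t)
    = sphere_point n (map tgt \<alpha>s, x, \<lambda>j\<in>{..<n}. simplex_map (\<alpha>s ! j) (t j))"
proof -
  have len: "length \<alpha>s = n" and \<alpha>: "\<And>j. j < n \<Longrightarrow> \<alpha>s ! j \<in> Delta_arr"
    using \<alpha>s by (auto simp: Delta_arrs_def)
  have tj: "t j \<in> standard_simplex (src (\<alpha>s ! j))" if "j < n" for j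
    using t that len by (auto simp: topspace_simplex_product PiE_iff)
  show ?thesis
  proof (cases "x = 0")
    case True
    show ?thesis unfolding True act_sphere_sset_0[OF len] sphere_point_0 ..
  next
    case False
    have "x \<le> prod_list (map tgt \<alpha>s)" using x len by (subst (asm) cells_sphere_sset) auto
    then obtain ijs where ijs: "interior_index (map tgt \<alpha>s) ijs" "x = encode (map tgt \<alpha>s) ijs"
      using encode_decode[of x "map tgt \<alpha>s"] False by (metis One_nat_def Suc_leI bot_nat_0.not_eq_extremum)
    have leni: "length ijs = n" and i: "\<And>j. j < n \<Longrightarrow> ijs ! j \<le> tgt (\<alpha>s ! j)"
      using ijs(1) len by (auto simp: interior_index_nth)
    define is' where "is' = map2 (\<lambda>\<alpha>. app (circle \<alpha>)) \<alpha>s ijs"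
    define u where "u j = tail_mass (tgt (\<alpha>s ! j)) (ijs ! j) (simplex_map (\<alpha>s ! j) (t j))" for j
    have is': "length is' = n" "\<And>j. j < n \<Longrightarrow> is' ! j = app (circle (\<alpha>s ! j)) (ijs ! j)"
      using len leni by (auto simp: is'_def)
    have act: "act (sphere_sset n) \<alpha>s x = encode (map src \<alpha>s) is'"
      unfolding ijs(2) is'_def by (rule act_sphere_sset_encode) (use len ijs in auto)
    have u: "if is' ! j = 0 then u j \<in> {0, 1}
        else u j = tail_mass (src (\<alpha>s ! j)) (is' ! j) (t j)" if "j < n" for j
      unfolding u_def is'(2)[OF that] by (rule tail_mass_circle) (use \<alpha> i tj that in auto)
    have rhs: "sphere_point n (map tgt \<alpha>s, x, \<lambda>j\<in>{..<n}. simplex_map (\<alpha>s ! j) (t j)) = pinch n u"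
      unfolding ijs(2) sphere_point_encode[OF ijs(1)]
      by (rule pinch_cong) (simp add: u_def len)
    show ?thesis
    proof (cases "0 \<in> set is'")
      case True
      then obtain j where j: "j < n" "is' ! j = 0" using is' by (metis in_set_conv_nth)
      have "0 \<le> u j \<and> u j \<le> 1" if "j < n" for j
        using u[OF that] tail_mass_bounds[OF tj[OF that]] by (auto split: if_splits)
      then have "pinch n u = None" using u[OF j(1)] j by (subst pinch_eq_None_iff) auto
      moreover have "encode (map src \<alpha>s) is' = 0"
        using True is' len by (intro encode_eq_0) auto
      ultimately show ?thesis unfolding rhs act by (simp add: sphere_point_0)
    next
      case False
      have "1 \<le> is' ! j \<and> is' ! j \<le> src (\<alpha>s ! j)" if "j < n" for j
      proof -
        have "is' ! j \<noteq> 0" using False is'(1) that by (metis nth_mem)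
        then show ?thesis
          using app_Fin_arr[OF circle_Fin_arr, of "ijs ! j" "\<alpha>s ! j"] i[OF that]
          by (simp add: is'(2)[OF that] circle_def)
      qed
      then have "interior_index (map src \<alpha>s) is'" using is' len by (auto simp: interior_index_nth)
      moreover have "is' ! j \<noteq> 0" if "j < n" for j using False is'(1) that by (metis nth_mem)
      ultimately show ?thesis
        unfolding rhs act by (simp add: sphere_point_encode) (rule pinch_cong, use u len in auto)
    qed
  qed
qed

lemma coend_equiv_imp_sphere_point_eq:
  assumes "(p, q) \<in> coend_equiv n (sphere_sset n)"
  shows "sphere_point n p = sphere_point n q"
proof -
  have glue: "sphere_point n p = sphere_point n q"
    if "(p, q) \<in> coend_glue n (sphere_sset n)" for p q
    using that sphere_point_glue unfolding coend_glue_def by blast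
  show ?thesis
    using assms unfolding coend_equiv_def
  proof (induction rule: rtrancl_induct)
    case (step q r)
    then show ?case using glue[of q r] glue[of r q] by auto
  qed simp
qed

section \<open>Normal forms in the coend\<close>

text \<open>
  The point of \<open>|\<Delta>\<^sup>1|\<close> with parameter \<open>u\<close> in \<open>[0, 1]\<close>, in barycentric coordinates.
\<close>

definition edge_point :: "real \<Rightarrow> nat \<Rightarrow> real" where
  "edge_point u = (\<lambda>l. if l = 0 then 1 - u else if l = 1 then u else 0)"

definition vertex :: "nat \<Rightarrow> real" where
  "vertex = (\<lambda>l. if l = 0 then 1 else 0)"

lemma edge_point_standard_simplex: "0 \<le> u \<Longrightarrow> u \<le> 1 \<Longrightarrow> edge_point u \<in> standard_simplex 1"
  by (auto simp: edge_point_def standard_simplex_def)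

lemma vertex_standard_simplex: "vertex \<in> standard_simplex 0"
  by (simp add: vertex_def standard_simplex_0)

lemma tail_mass_edge_point: "tail_mass 1 1 (edge_point u) = u"
  by (simp add: tail_mass_def edge_point_def)

definition cut_arr :: "nat \<Rightarrow> nat \<Rightarrow> arr" where
  "cut_arr k i = \<lparr>src = k, tgt = 1, app = (\<lambda>l\<in>{..k}. interval_simplex i l)\<rparr>"

definition collapse_arr :: "nat \<Rightarrow> arr" where
  "collapse_arr k = \<lparr>src = k, tgt = 0, app = (\<lambda>l\<in>{..k}. 0)\<rparr>"

lemma cut_arr_Delta_arr: "cut_arr k i \<in> Delta_arr"
  by (auto simp: Delta_arr_def cut_arr_def interval_simplex_def mono_on_def)

lemma collapse_arr_Delta_arr: "collapse_arr k \<in> Delta_arr"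
  by (auto simp: Delta_arr_def collapse_arr_def mono_on_def)

lemma id_arr_Delta_arr: "id_arr k \<in> Delta_arr"
  by (auto simp: Delta_arr_def id_arr_def mono_on_def)

lemma app_circle_cut_arr:
  assumes "i \<le> k"
  shows "app (circle (cut_arr k i)) 1 = i"
proof -
  have "circle_class k (interval_simplex 1 \<circ> app (cut_arr k i)) = circle_class k (interval_simplex i)"
    by (rule circle_class_cong) (simp add: cut_arr_def interval_simplex_def)
  then show ?thesis
    using circle_class_interval_simplex[OF assms] by (simp add: circle_def) (simp add: cut_arr_def)
qed

lemma simplex_map_cut_arr:
  assumes "t \<in> standard_simplex k"
  shows "simplex_map (cut_arr k i) t = edge_point (tail_mass k i t)"
proof
  fix j
  have low: "(\<Sum>l | l \<le> k \<and> \<not> i \<le> l. t l) = 1 - tail_mass k i t"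
  proof -
    have "{..k} = {l. l \<le> k \<and> \<not> i \<le> l} \<union> {i..k}" by auto
    then have "(\<Sum>l\<le>k. t l) = (\<Sum>l | l \<le> k \<and> \<not> i \<le> l. t l) + tail_mass k i t"
      unfolding tail_mass_def by (simp only:) (rule sum.union_disjoint, auto)
    then show ?thesis using assms by (simp add: standard_simplex_def)
  qed
  have sets: "{l. l \<le> k \<and> app (cut_arr k i) l = j}
      = (if j = 0 then {l. l \<le> k \<and> \<not> i \<le> l} else if j = 1 then {i..k} else {})"
    by (auto simp: cut_arr_def interval_simplex_def split: if_splits)
  have "src (cut_arr k i) = k" by (simp add: cut_arr_def)
  then show "simplex_map (cut_arr k i) t j = edge_point (tail_mass k i t) j"
    unfolding simplex_map_def by (simp add: sets low edge_point_def) (simp add: tail_mass_def)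
qed

lemma simplex_map_collapse_arr:
  assumes "t \<in> standard_simplex k"
  shows "simplex_map (collapse_arr k) t = vertex"
proof
  fix j
  have "{l. l \<le> k \<and> app (collapse_arr k) l = j} = (if j = 0 then {..k} else {})"
    by (auto simp: collapse_arr_def)
  moreover have "src (collapse_arr k) = k" by (simp add: collapse_arr_def)
  ultimately show "simplex_map (collapse_arr k) t j = vertex j"
    using assms by (simp add: simplex_map_def vertex_def standard_simplex_def)
qed

lemma simplex_map_id_arr:
  assumes "t \<in> standard_simplex k"
  shows "simplex_map (id_arr k) t = t"
proof
  fix j
  have "{l. l \<le> k \<and> app (id_arr k) l = j} = (if j \<le> k then {j} else {})"
    by (auto simp: id_arr_def)
  moreover have "src (id_arr k) = k" by (simp add: id_arr_def)
  ultimately show "simplex_map (id_arr k) t j = t j"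
    using assms by (simp add: simplex_map_def standard_simplex_def)
qed

lemma equiv_coend_equiv: "equiv UNIV (coend_equiv n X)"
proof -
  have "sym (coend_glue n X \<union> (coend_glue n X)\<inverse>)" by (rule sym_Un_converse)
  then have "sym (coend_equiv n X)" unfolding coend_equiv_def by (rule sym_rtrancl)
  then show ?thesis
    unfolding equiv_def coend_equiv_def by (simp add: refl_rtrancl trans_rtrancl)
qed

lemma coend_equivI:
  assumes "\<alpha>s \<in> Delta_arrs n" "map src \<alpha>s = ks" "map tgt \<alpha>s = ls"
    "x \<in> cells X ls" "t \<in> topspace (simplex_product ks)"
    "act X \<alpha>s x = y" "\<And>j. j < n \<Longrightarrow> simplex_map (\<alpha>s ! j) (t j) = s j" "s \<in> extensional {..<n}"
  shows "((ks, y, t), (ls, x, s)) \<in> coend_equiv n X"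
proof -
  have "s = (\<lambda>j\<in>{..<n}. simplex_map (\<alpha>s ! j) (t j))"
    using assms(7,8) by (auto simp: fun_eq_iff extensional_def)
  then have "((ks, y, t), (ls, x, s)) \<in> coend_glue n X"
    using assms(1-6) unfolding coend_glue_def by blast
  then show ?thesis unfolding coend_equiv_def by blast
qed

text \<open>
  The basepoint simplex of any multidegree is pulled back from multidegree \<open>[0, \<dots>, 0]\<close>, whose
  topological simplex is a point.
\<close>

lemma coend_equiv_base:
  assumes "length ks = n" "t \<in> topspace (simplex_product ks)"
  shows "((ks, 0, t), (replicate n 0, 0, \<lambda>j\<in>{..<n}. vertex)) \<in> coend_equiv n (sphere_sset n)"
proof (rule coend_equivI)
  have len: "length (map collapse_arr ks) = n" using assms by simp
  show "map collapse_arr ks \<in> Delta_arrs n"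
    using assms by (auto simp: Delta_arrs_def collapse_arr_Delta_arr)
  show "map src (map collapse_arr ks) = ks"
    by (simp add: collapse_arr_def comp_def)
  show "map tgt (map collapse_arr ks) = replicate n 0"
    using assms by (simp add: collapse_arr_def comp_def map_replicate_const)
  show "0 \<in> cells (sphere_sset n) (replicate n 0)"
    by (subst cells_sphere_sset) auto
  show "act (sphere_sset n) (map collapse_arr ks) 0 = 0" by (rule act_sphere_sset_0[OF len])
  show "simplex_map (map collapse_arr ks ! j) (t j) = (\<lambda>j\<in>{..<n}. vertex) j" if "j < n" for j
    using assms that by (simp add: topspace_simplex_product PiE_iff simplex_map_collapse_arr)
qed (use assms in auto)

lemma interior_index_ones: "interior_index (replicate n 1) (replicate n 1)"
  by (simp add: interior_index_nth)

lemma encode_ones: "encode (replicate n 1) (replicate n 1) = 1"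
  using decode_encode[OF interior_index_ones, of n] by simp

text \<open>
  Every other simplex is pulled back from the only nondegenerate one among them, the simplex \<open>1\<close> of
  multidegree \<open>[1, \<dots>, 1]\<close>, along the maps \<open>interval_simplex i\<^sub>j\<close>.
\<close>

lemma coend_equiv_edges:
  assumes "length ks = n" "interior_index ks ijs" "t \<in> topspace (simplex_product ks)"
  shows "((ks, encode ks ijs, t),
      (replicate n 1, 1, \<lambda>j\<in>{..<n}. edge_point (tail_mass (ks ! j) (ijs ! j) (t j))))
    \<in> coend_equiv n (sphere_sset n)"
proof (rule coend_equivI)
  define \<alpha>s where "\<alpha>s = map2 cut_arr ks ijs"
  have leni: "length ijs = n" using assms by (simp add: interior_index_nth)
  have i: "1 \<le> ijs ! j" "ijs ! j \<le> ks ! j" if "j < n" for j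
    using assms that by (auto simp: interior_index_nth)
  have len: "length \<alpha>s = n" using assms leni by (simp add: \<alpha>s_def)
  have \<alpha>: "\<alpha>s ! j = cut_arr (ks ! j) (ijs ! j)" if "j < n" for j
    using that leni assms by (simp add: \<alpha>s_def)
  show "\<alpha>s \<in> Delta_arrs n"
    using len by (auto simp: Delta_arrs_def in_set_conv_nth \<alpha> cut_arr_Delta_arr)
  show "map src \<alpha>s = ks"
    using len assms(1) by (intro nth_equalityI) (simp_all add: \<alpha>, simp add: cut_arr_def)
  show tgt: "map tgt \<alpha>s = replicate n 1"
    using len by (intro nth_equalityI) (simp_all add: \<alpha>, simp add: cut_arr_def)
  have "act (sphere_sset n) \<alpha>s (encode (map tgt \<alpha>s) (replicate n 1))
      = encode (map src \<alpha>s) (map2 (\<lambda>\<alpha>. app (circle \<alpha>)) \<alpha>s (replicate n 1))"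
    by (rule act_sphere_sset_encode) (use len interior_index_ones tgt in auto)
  moreover have "map2 (\<lambda>\<alpha>. app (circle \<alpha>)) \<alpha>s (replicate n 1) = ijs"
    using len leni app_circle_cut_arr[OF i(2)] by (intro nth_equalityI) (simp_all add: \<alpha>)
  ultimately show "act (sphere_sset n) \<alpha>s 1 = encode ks ijs"
    by (simp only: tgt encode_ones \<open>map src \<alpha>s = ks\<close>)
  show "1 \<in> cells (sphere_sset n) (replicate n 1)"
    by (subst cells_sphere_sset) auto
  show "simplex_map (\<alpha>s ! j) (t j)
      = (\<lambda>j\<in>{..<n}. edge_point (tail_mass (ks ! j) (ijs ! j) (t j))) j" if "j < n" for j
    using assms that
    by (simp add: \<alpha> topspace_simplex_product PiE_iff simplex_map_cut_arr)
qed (use assms in auto)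

text \<open>
  A face operator in direction \<open>j0\<close> moves such a point to multidegree \<open>[1, \<dots>, 0, \<dots>, 1]\<close>, where the
  basepoint is the only simplex.
\<close>

lemma coend_equiv_boundary:
  assumes u: "\<And>j. j < n \<Longrightarrow> 0 \<le> u j \<and> u j \<le> 1" and j0: "j0 < n" "u j0 \<in> {0, 1}"
  shows "((replicate n 1, 1, \<lambda>j\<in>{..<n}. edge_point (u j)),
      (replicate n 0, 0, \<lambda>j\<in>{..<n}. vertex)) \<in> coend_equiv n (sphere_sset n)"
proof -
  let ?R = "coend_equiv n (sphere_sset n)"
  \<comment> \<open>The map \<open>[0] \<rightarrow> [1]\<close> that cuts at \<open>0\<close> has the value \<open>1\<close>, and the one that cuts at \<open>1\<close> has the value \<open>0\<close>.\<close>
  let ?i = "if u j0 = 1 then 0 else 1"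
  define \<alpha>s where "\<alpha>s = (replicate n (id_arr 1))[j0 := cut_arr 0 ?i]"
  define ks where "ks = (replicate n 1)[j0 := 0 :: nat]"
  define t where "t = (\<lambda>j\<in>{..<n}. if j = j0 then vertex else edge_point (u j))"
  have len: "length \<alpha>s = n" by (simp add: \<alpha>s_def)
  have lenk: "length ks = n" by (simp add: ks_def)
  have \<alpha>: "\<alpha>s ! j = (if j = j0 then cut_arr 0 ?i else id_arr 1)" if "j < n" for j
    using that by (simp add: \<alpha>s_def nth_list_update)
  have \<alpha>s: "\<alpha>s \<in> Delta_arrs n"
    using len by (auto simp: Delta_arrs_def in_set_conv_nth \<alpha> cut_arr_Delta_arr id_arr_Delta_arr)
  have src: "map src \<alpha>s = ks"
    by (rule nth_equalityI)
      (simp_all add: len lenk \<alpha>, simp add: ks_def nth_list_update cut_arr_def id_arr_def)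
  have tgt: "map tgt \<alpha>s = replicate n 1"
    by (rule nth_equalityI) (simp_all add: len \<alpha>, simp add: cut_arr_def id_arr_def)
  have t: "t \<in> topspace (simplex_product ks)"
    using vertex_standard_simplex edge_point_standard_simplex u
    by (auto simp: topspace_simplex_product t_def ks_def nth_list_update)
  have one: "1 \<in> cells (sphere_sset n) (map tgt \<alpha>s)"
    using len unfolding tgt by (subst cells_sphere_sset) auto
  have "multi_sset n (sphere_sset n)"
    by (intro multi_sset_eval_at multi_module_deloop_F1)
  then have "act (sphere_sset n) \<alpha>s 1 \<in> cells (sphere_sset n) (map src \<alpha>s)"
    using \<alpha>s one unfolding multi_sset_def by blast
  moreover have "prod_list ks = 0"
    using set_update_memI[of j0 "replicate n 1" "0::nat"] j0 by (simp add: ks_def prod_list_zero_iff)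
  ultimately have act: "act (sphere_sset n) \<alpha>s 1 = 0"
    unfolding src cells_sphere_sset[OF lenk] by simp
  have "simplex_map (cut_arr 0 ?i) vertex = edge_point (u j0)"
    unfolding simplex_map_cut_arr[OF vertex_standard_simplex]
    using j0(2) by (auto simp: tail_mass_def vertex_def)
  then have "simplex_map (\<alpha>s ! j) (t j) = (\<lambda>j\<in>{..<n}. edge_point (u j)) j" if "j < n" for j
    using that u simplex_map_id_arr[OF edge_point_standard_simplex] by (simp add: \<alpha> t_def)
  then have "((ks, 0, t), (replicate n 1, 1, \<lambda>j\<in>{..<n}. edge_point (u j))) \<in> ?R"
    by (intro coend_equivI[OF \<alpha>s src tgt _ t act]) (use one tgt in auto)
  moreover have "((ks, 0, t), (replicate n 0, 0, \<lambda>j\<in>{..<n}. vertex)) \<in> ?R"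
    using lenk t by (rule coend_equiv_base)
  ultimately show ?thesis
    using equiv_coend_equiv[of n "sphere_sset n"] by (meson equiv_def symD transD)
qed

text \<open>
  Every point is equivalent either to the base vertex or to a point of the open cube in multidegree
  \<open>[1, \<dots>, 1]\<close>, and \<open>sphere_point\<close> tells these normal forms apart.
\<close>

lemma sphere_point_eq_imp_coend_equiv:
  assumes p: "p \<in> topspace (realization_sum n (sphere_sset n))"
    and q: "q \<in> topspace (realization_sum n (sphere_sset n))"
    and eq: "sphere_point n p = sphere_point n q"
  shows "(p, q) \<in> coend_equiv n (sphere_sset n)"
proof -
  let ?R = "coend_equiv n (sphere_sset n)"
  let ?base = "(replicate n 0, 0, \<lambda>j\<in>{..<n}. vertex)"
  have normal_form: "(r, ?base) \<in> ?R \<and> sphere_point n r = None \<or>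
      (\<exists>u. (\<forall>j<n. 0 \<le> u j \<and> u j \<le> 1) \<and> sphere_point n r = pinch n u \<and> pinch n u \<noteq> None \<and>
        (r, (replicate n 1, 1, \<lambda>j\<in>{..<n}. edge_point (u j))) \<in> ?R)"
    if "r \<in> topspace (realization_sum n (sphere_sset n))" for r
  proof -
    obtain ks x t where r: "r = (ks, x, t)" and len: "length ks = n"
      and x: "x \<in> cells (sphere_sset n) ks" and t: "t \<in> topspace (simplex_product ks)"
      using \<open>r \<in> _\<close> by (auto simp: topspace_realization_sum)
    show ?thesis
    proof (cases "x = 0")
      case True
      then show ?thesis using coend_equiv_base[OF len t] by (simp add: r sphere_point_0)
    next
      case False
      then obtain ijs where ijs: "interior_index ks ijs" "x = encode ks ijs"
        using encode_decode[of x ks] x unfolding cells_sphere_sset[OF len]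
        by (metis One_nat_def Suc_leI atMost_iff bot_nat_0.not_eq_extremum)
      define u where "u j = tail_mass (ks ! j) (ijs ! j) (t j)" for j
      have u: "0 \<le> u j \<and> u j \<le> 1" if "j < n" for j
        using t that len tail_mass_bounds by (auto simp: u_def topspace_simplex_product PiE_iff)
      have edges: "(r, (replicate n 1, 1, \<lambda>j\<in>{..<n}. edge_point (u j))) \<in> ?R"
        unfolding r ijs(2) u_def by (rule coend_equiv_edges[OF len ijs(1) t])
      have point: "sphere_point n r = pinch n u"
        unfolding r ijs(2) u_def by (rule sphere_point_encode[OF ijs(1)])
      show ?thesis
      proof (cases "pinch n u = None")
        case True
        then obtain j where "j < n" "u j \<in> {0, 1}" using u by (subst (asm) pinch_eq_None_iff) auto
        from coend_equiv_boundary[of n u, OF u this] have "(r, ?base) \<in> ?R"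
          using edges equiv_coend_equiv[of n "sphere_sset n"] by (meson equiv_def transD)
        then show ?thesis using True point by simp
      next
        case False
        then show ?thesis using u edges point by blast
      qed
    qed
  qed
  have "\<exists>z. (p, z) \<in> ?R \<and> (q, z) \<in> ?R"
  proof (cases "sphere_point n p = None")
    case True
    then show ?thesis using normal_form[OF p] normal_form[OF q] eq by metis
  next
    case False
    then obtain u v where u: "\<forall>j<n. 0 \<le> u j \<and> u j \<le> 1" "sphere_point n p = pinch n u"
        "(p, (replicate n 1, 1, \<lambda>j\<in>{..<n}. edge_point (u j))) \<in> ?R"
      and v: "sphere_point n q = pinch n v"
        "(q, (replicate n 1, 1, \<lambda>j\<in>{..<n}. edge_point (v j))) \<in> ?R"
      using normal_form[OF p] normal_form[OF q] eq by metis
    have "u j = v j" if "j < n" for j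
      using pinch_inject[of n u v] u v False eq that by metis
    then have "(\<lambda>j\<in>{..<n}. edge_point (u j)) = (\<lambda>j\<in>{..<n}. edge_point (v j))" by auto
    then show ?thesis using u v by metis
  qed
  then show ?thesis using equiv_coend_equiv[of n "sphere_sset n"] by (meson equiv_def symD transD)
qed

section \<open>The realization and the collapsed disc as quotients\<close>

text \<open>
  The space \<open>realization_sum n X\<close> is a disjoint union of products of simplices, one for each simplex
  of \<open>X\<close>, so that openness can be tested on each of them.
\<close>

lemma openin_realization_sum_vimage:
  "openin (realization_sum n X) {p \<in> topspace (realization_sum n X). f p \<in> U} \<longleftrightarrow>
    (\<forall>ks x. length ks = n \<longrightarrow> x \<in> cells X ks \<longrightarrow>
      openin (simplex_product ks) {t \<in> topspace (simplex_product ks). f (ks, x, t) \<in> U})"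
proof -
  have slice: "openin (prod_topology (discrete_topology C) S) {(x, t). x \<in> C \<and> t \<in> topspace S \<and> P x t}
      \<longleftrightarrow> (\<forall>x\<in>C. openin S {t \<in> topspace S. P x t})"
    for C :: "'a set" and S :: "(nat \<Rightarrow> nat \<Rightarrow> real) topology" and P
  proof
    assume *: "openin (prod_topology (discrete_topology C) S) {(x, t). x \<in> C \<and> t \<in> topspace S \<and> P x t}"
    show "\<forall>x\<in>C. openin S {t \<in> topspace S. P x t}"
    proof
      fix x assume x: "x \<in> C"
      then have "continuous_map S (prod_topology (discrete_topology C) S) (\<lambda>t. (x, t))"
        by (simp add: continuous_map_pairedI)
      from openin_continuous_map_preimage[OF this *]
      show "openin S {t \<in> topspace S. P x t}" by (rule back_subst[of "openin S"]) (use x in auto)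
    qed
  next
    assume *: "\<forall>x\<in>C. openin S {t \<in> topspace S. P x t}"
    then have "openin (prod_topology (discrete_topology C) S)
        (\<Union>x\<in>C. {x} \<times> {t \<in> topspace S. P x t})"
      by (intro openin_Union) (auto simp: openin_prod_Times_iff)
    then show "openin (prod_topology (discrete_topology C) S) {(x, t). x \<in> C \<and> t \<in> topspace S \<and> P x t}"
      by (rule back_subst[of "openin _"]) auto
  qed
  have "openin (realization_sum n X) {p \<in> topspace (realization_sum n X). f p \<in> U} \<longleftrightarrow>
    (\<forall>ks\<in>{ks. length ks = n}. openin (prod_topology (discrete_topology (cells X ks)) (simplex_product ks))
      {(x, t). x \<in> cells X ks \<and> t \<in> topspace (simplex_product ks) \<and> f (ks, x, t) \<in> U})"
  proof -
    have "{xt. (ks, xt) \<in> {p \<in> topspace (realization_sum n X). f p \<in> U}}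
        = {(x, t). x \<in> cells X ks \<and> t \<in> topspace (simplex_product ks) \<and> f (ks, x, t) \<in> U}"
      if "length ks = n" for ks
      using that by (auto simp: topspace_realization_sum)
    then show ?thesis
      unfolding realization_sum_def openin_sum_topology by auto
  qed
  then show ?thesis unfolding slice by blast
qed

lemma Hausdorff_space_disc: "Hausdorff_space (disc n)"
  unfolding disc_def by (intro Hausdorff_space_subtopology Hausdorff_Euclidean_space)

lemma compact_space_simplex_product: "compact_space (simplex_product ks)"
  unfolding simplex_product_def compact_space_product_topology
  using compactin_standard_simplex compact_space_subtopology by blast

lemma cube_coordinate_bounds:
  assumes "t \<in> topspace (simplex_product ks)" "j < length ks"
  shows "\<bar>2 * tail_mass (ks ! j) i (t j) - 1\<bar> \<le> 1"
proof -
  have "t j \<in> standard_simplex (ks ! j)"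
    using assms by (auto simp: topspace_simplex_product PiE_iff)
  from tail_mass_bounds[OF this, of i] show ?thesis by (simp add: abs_le_iff)
qed

lemma simplex_product_to_disc:
  assumes "t \<in> topspace (simplex_product ks)" "length ks = n"
  shows "cube_to_disc n (\<lambda>j. 2 * tail_mass (ks ! j) (ijs ! j) (t j) - 1) \<in> topspace (disc n)"
  by (rule cube_to_disc_in_disc) (use assms cube_coordinate_bounds in blast)

lemma continuous_map_simplex_product_disc:
  assumes "length ks = n"
  shows "continuous_map (simplex_product ks) (disc n)
    (\<lambda>t. cube_to_disc n (\<lambda>j. 2 * tail_mass (ks ! j) (ijs ! j) (t j) - 1))"
proof -
  have coord: "continuous_map (simplex_product ks) euclideanreal (\<lambda>t. t j l)" if "j < n" for j l
  proof -
    have "continuous_map (simplex_product ks)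
        (subtopology (powertop_real UNIV) (standard_simplex (ks ! j))) (\<lambda>t. t j)"
      unfolding simplex_product_def
      using continuous_map_product_projection[of j "{..<length ks}"
          "\<lambda>i. subtopology (powertop_real UNIV) (standard_simplex (ks ! i))"] that assms by simp
    then have "continuous_map (simplex_product ks) (powertop_real UNIV) (\<lambda>t. t j)"
      by (simp add: continuous_map_in_subtopology)
    then show ?thesis by (simp add: continuous_map_componentwise_UNIV)
  qed
  have "continuous_map (simplex_product ks) (Euclidean_space n)
    (\<lambda>t. cube_to_disc n (\<lambda>j. 2 * tail_mass (ks ! j) (ijs ! j) (t j) - 1))"
    unfolding cube_to_disc_def continuous_map_componentwise_Euclidean_space tail_mass_def
    by (intro allI impI continuous_intros coord) auto
  then show ?thesis
    using simplex_product_to_disc[OF _ assms]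
    by (simp add: disc_def continuous_map_in_subtopology image_subset_iff)
qed

lemma tail_mass_edge_points:
  assumes "j < n"
  shows "tail_mass (replicate n 1 ! j) (replicate n 1 ! j) (edge_point u) = u"
  using assms tail_mass_edge_point by simp

text \<open>
  Multidegree \<open>[1, \<dots>, 1]\<close> alone covers the disc, and a continuous surjection from a compact space
  to a Hausdorff space is a quotient map.
\<close>

lemma quotient_map_edges_disc:
  "quotient_map (simplex_product (replicate n 1)) (disc n)
    (\<lambda>t. cube_to_disc n (\<lambda>j. 2 * tail_mass (replicate n 1 ! j) (replicate n 1 ! j) (t j) - 1))"
    (is "quotient_map ?S _ ?f")
proof (rule T1_Spaces.continuous_imp_quotient_map)
  show cont: "continuous_map ?S (disc n) ?f"
    by (rule continuous_map_simplex_product_disc) simp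
  show "?f ` topspace ?S = topspace (disc n)"
  proof
    show "?f ` topspace ?S \<subseteq> topspace (disc n)" using cont by (rule continuous_map_image_subset_topspace)
    show "topspace (disc n) \<subseteq> ?f ` topspace ?S"
    proof
      fix y assume "y \<in> topspace (disc n)"
      then obtain x where x: "\<And>i. i < n \<Longrightarrow> \<bar>x i\<bar> \<le> 1" "cube_to_disc n x = y"
        by (rule cube_to_disc_surj) blast
      define t where "t = (\<lambda>j\<in>{..<n}. edge_point ((1 + x j) / 2))"
      have "edge_point ((1 + x j) / 2) \<in> standard_simplex 1" if "j < n" for j
        using x(1)[OF that] by (intro edge_point_standard_simplex) (simp_all add: abs_le_iff)
      then have "t \<in> topspace ?S" by (simp add: t_def topspace_simplex_product PiE_iff)
      moreover have "?f t = cube_to_disc n x"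
      proof (rule cube_to_disc_cong)
        fix j assume j: "j < n"
        show "2 * tail_mass (replicate n 1 ! j) (replicate n 1 ! j) (t j) - 1 = x j"
          using tail_mass_edge_points[OF j, of "(1 + x j) / 2"] j by (simp add: t_def)
      qed
      then have "?f t = y" using x(2) by simp
      ultimately show "y \<in> ?f ` topspace ?S" by blast
    qed
  qed
qed (simp_all add: compact_space_simplex_product Hausdorff_space_disc)

lemma sphere_point_ones:
  "sphere_point n (replicate n 1, 1, t)
    = pinch n (\<lambda>j. tail_mass (replicate n 1 ! j) (replicate n 1 ! j) (t j))"
  using sphere_point_encode[OF interior_index_ones, of n n t] unfolding encode_ones .

lemma sphere_point_range:
  "sphere_point n ` topspace (realization_sum n (sphere_sset n))
    = insert None (Some ` (topspace (disc n) - disc_boundary n))" (is "?L = insert None ?I")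
proof
  show "?L \<subseteq> insert None ?I"
  proof
    fix z assume "z \<in> ?L"
    then obtain ks x t where z: "z = sphere_point n (ks, x, t)"
      and ks: "length ks = n" "t \<in> topspace (simplex_product ks)"
      by (auto simp: topspace_realization_sum)
    have "cube_to_disc n (\<lambda>j. 2 * tail_mass (ks ! j) (decode ks x ! j) (t j) - 1)
        \<in> topspace (disc n)"
      by (rule simplex_product_to_disc[OF ks(2,1)])
    then show "z \<in> insert None ?I"
      by (auto simp: z sphere_point_def pinch_def Let_def)
  qed
  have "None \<in> ?L"
  proof
    show "None = sphere_point n (replicate n 0, 0, \<lambda>j\<in>{..<n}. vertex)"
      by (simp add: sphere_point_0)
    have "0 \<in> cells (sphere_sset n) (replicate n 0)" by (subst cells_sphere_sset) auto
    then show "(replicate n 0, 0, \<lambda>j\<in>{..<n}. vertex) \<in> topspace (realization_sum n (sphere_sset n))"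
      using vertex_standard_simplex
      by (auto simp: topspace_realization_sum topspace_simplex_product)
  qed
  moreover have "Some y \<in> ?L" if y: "y \<in> topspace (disc n)" "y \<notin> disc_boundary n" for y
  proof -
    have "y \<in> (\<lambda>t. cube_to_disc n
        (\<lambda>j. 2 * tail_mass (replicate n 1 ! j) (replicate n 1 ! j) (t j) - 1)) `
        topspace (simplex_product (replicate n 1))"
      unfolding quotient_imp_surjective_map[OF quotient_map_edges_disc] by (rule y(1))
    then obtain t where
      t: "y = cube_to_disc n (\<lambda>j. 2 * tail_mass (replicate n 1 ! j) (replicate n 1 ! j) (t j) - 1)"
        "t \<in> topspace (simplex_product (replicate n 1))"
      by (rule imageE)
    have "sphere_point n (replicate n 1, 1, t) = Some y"
      unfolding sphere_point_ones pinch_def t(1)[symmetric] using y(2) by simp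
    moreover have "1 \<in> cells (sphere_sset n) (replicate n 1)" by (subst cells_sphere_sset) auto
    then have "(replicate n 1, 1, t) \<in> topspace (realization_sum n (sphere_sset n))"
      using t(2) by (simp add: topspace_realization_sum)
    then have "sphere_point n (replicate n 1, 1, t) \<in> ?L" by (rule imageI)
    ultimately show ?thesis by (simp only:)
  qed
  ultimately show "insert None ?I \<subseteq> ?L" by auto
qed


text \<open>
  Every open set of the collapsed disc is open on the left because each component of \<open>sphere_point\<close> is constant or lifts
  continuously to the disc. The converse holds because the component of the nondegenerate simplex
  lifts to a quotient map onto the disc.
\<close>

lemma final_topology_sphere_point:
  "final_topology (insert None (Some ` (topspace (disc n) - disc_boundary n)))
     (realization_sum n (sphere_sset n)) (sphere_point n)
   = collapse (disc n) (disc_boundary n)"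
proof -
  define q where "q y = (if y \<in> disc_boundary n then None else Some y)" for y
  define Y where "Y = insert None (Some ` (topspace (disc n) - disc_boundary n))"
  define X where "X = sphere_sset n"
  have pinch: "pinch n u = q (cube_to_disc n (\<lambda>j. 2 * u j - 1))" for u
    by (simp add: pinch_def q_def Let_def)
  have "openin (disc n) {y \<in> topspace (disc n). q y \<in> U} \<longleftrightarrow>
      openin (realization_sum n X) {p \<in> topspace (realization_sum n X). sphere_point n p \<in> U}" for U
    unfolding openin_realization_sum_vimage
  proof (intro iffI allI impI)
    fix ks x
    assume U: "openin (disc n) {y \<in> topspace (disc n). q y \<in> U}" and ks: "length (ks :: nat list) = n"
    let ?f = "\<lambda>t. cube_to_disc n (\<lambda>j. 2 * tail_mass (ks ! j) (decode ks x ! j) (t j) - 1)"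
    have f: "continuous_map (simplex_product ks) (disc n) ?f"
      by (rule continuous_map_simplex_product_disc[OF ks])
    show "openin (simplex_product ks)
        {t \<in> topspace (simplex_product ks). sphere_point n (ks, x, t) \<in> U}"
    proof (cases "x = 0")
      case False
      have "openin (simplex_product ks)
          {t \<in> topspace (simplex_product ks). ?f t \<in> {y \<in> topspace (disc n). q y \<in> U}}"
        using f U by (rule openin_continuous_map_preimage)
      also have "{t \<in> topspace (simplex_product ks). ?f t \<in> {y \<in> topspace (disc n). q y \<in> U}}
          = {t \<in> topspace (simplex_product ks). sphere_point n (ks, x, t) \<in> U}"
        using f False by (auto simp: sphere_point_def pinch continuous_map_def)
      finally show ?thesis .
    qed (cases "None \<in> U"; simp add: sphere_point_0)
  next
    let ?S = "simplex_product (replicate n 1)"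
    let ?f = "\<lambda>t. cube_to_disc n (\<lambda>j. 2 * tail_mass (replicate n 1 ! j) (replicate n 1 ! j) (t j) - 1)"
    assume U: "\<forall>ks x. length ks = n \<longrightarrow> x \<in> cells X ks \<longrightarrow> openin (simplex_product ks)
        {t \<in> topspace (simplex_product ks). sphere_point n (ks, x, t) \<in> U}"
    have f: "quotient_map ?S (disc n) ?f" by (rule quotient_map_edges_disc)
    have mem: "?f t \<in> topspace (disc n)" if "t \<in> topspace ?S" for t
      using imageI[OF that, of ?f] unfolding quotient_imp_surjective_map[OF f] .
    have "1 \<in> cells X (replicate n 1)" unfolding X_def by (subst cells_sphere_sset) auto
    then have *: "openin ?S {t \<in> topspace ?S. sphere_point n (replicate n 1, 1, t) \<in> U}"
      using U by simp
    have "{t \<in> topspace ?S. sphere_point n (replicate n 1, 1, t) \<in> U}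
        = {t \<in> topspace ?S. ?f t \<in> {y \<in> topspace (disc n). q y \<in> U}}"
      by (intro Collect_cong conj_cong refl)
        (simp only: sphere_point_ones pinch mem mem_Collect_eq simp_thms)
    with * have "openin ?S {t \<in> topspace ?S. ?f t \<in> {y \<in> topspace (disc n). q y \<in> U}}"
      by (simp only:)
    moreover have "{y \<in> topspace (disc n). q y \<in> U} \<subseteq> topspace (disc n)" by blast
    ultimately show "openin (disc n) {y \<in> topspace (disc n). q y \<in> U}"
      using f unfolding quotient_map_def by blast
  qed
  then have "final_topology Y (realization_sum n X) (sphere_point n) = final_topology Y (disc n) q"
    by (simp add: topology_eq openin_final_topology)
  then show ?thesis by (simp add: collapse_def Y_def X_def q_def[abs_def])
qed

theorem theorem3p10:
  fixes n :: nat
  shows "geometric_realization n (eval_at ((deloop ^^ n) F1) 1)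
           homeomorphic_space collapse (disc n) (disc_boundary n)"
proof -
  let ?T = "realization_sum n (sphere_sset n)"
  let ?R = "coend_equiv n (sphere_sset n)"
  have "?R `` {p} = ?R `` {q} \<longleftrightarrow> sphere_point n p = sphere_point n q"
    if "p \<in> topspace ?T" "q \<in> topspace ?T" for p q
    using that sphere_point_eq_imp_coend_equiv coend_equiv_imp_sphere_point_eq
      eq_equiv_class_iff[OF equiv_coend_equiv UNIV_I UNIV_I, of n "sphere_sset n" p q] by blast
  then have "final_topology (topspace ?T // ?R) ?T (\<lambda>p. ?R `` {p}) homeomorphic_space
      final_topology (insert None (Some ` (topspace (disc n) - disc_boundary n))) ?T (sphere_point n)"
    by (intro homeomorphic_final_topologies sphere_point_range) (auto simp: quotient_def)
  then show ?thesis
    unfolding final_topology_sphere_point geometric_realization_def .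
qed

end
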